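(* Let $n\ge 1$ be an integer and $0<s<1$. For any $1<p<+\infty$, the equation $$(\partial_t-\Delta)^s u(x,t)=x_1u^p(x,t)\quad\text{in } \mathbb{R}^n\times\mathbb{R},$$ where $x=(x_1,\dots,x_n)$, possesses no positive bounded classical solutions.
   Context: For $0<s<1$ the fully fractional heat (master) operator is $$(\partial_t-\Delta)^s u(x,t):=C_{n,s}\int_{-\infty}^{t}\int_{\mathbb{R}^n}\frac{u(x,t)-u(y,\tau)}{(t-\tau)^{\frac n2+1+s}}\,e^{-\frac{|x-y|^2}{4(t-\tau)}}\,dy\,d\tau,\qquad C_{n,s}=\frac{1}{(4\pi)^{n/2}|\Gamma(-s)|},$$ where the integral in $y$ is in the sense of Cauchy principal value. $\mathcal{L}(\mathbb{R}^n\times\mathbb{R})$ is the set of $u\in L^1_{\mathrm{loc}}(\mathbb{R}^n\times\mathbb{R})$ such that $\int_{-\infty}^t\int_{\mathbb{R}^n}\frac{|u(x,\tau)|e^{-|x|^2/(4(t-\tau))}}{1+(t-\tau)^{\frac n2+1+s}}\,dx\,d\tau<\infty$ for every $t\in\mathbb{R}$. Parabolic Hölder spaces $C^{2\alpha,\alpha}_{x,t}(\mathbb{R}^n\times\mathbb{R})$: (i) for $0<\alpha\le\frac12$, $u$ belongs to it if there is $C>0$ with $|u(x,t)-u(y,\tau)|\le C(|x-y|+|t-\tau|^{1/2})^{2\alpha}$ for all $x,y\in\mathbb{R}^n$, $t,\tau\in\mathbb{R}$; (ii) for $\frac12<\alpha\le1$, if $u$ is $\alpha$-Hölder continuous in $t$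 uniformly in $x$, and $\nabla_x u$ is $(2\alpha-1)$-Hölder continuous in $x$ uniformly in $t$ and $(\alpha-\frac12)$-Hölder continuous in $t$ uniformly in $x$; (iii) for $\alpha>1$, if $\partial_tu, D_x^2u\in C^{2\alpha-2,\alpha-1}_{x,t}(\mathbb{R}^n\times\mathbb{R})$. The local space $C^{2\alpha,\alpha}_{x,t,\mathrm{loc}}$ is defined analogously, with the conditions required on bounded subsets of $\mathbb{R}^n\times\mathbb{R}$. The condition "$u\in C^{2s+\epsilon,s+\epsilon}_{x,t,\mathrm{loc}}(\mathbb{R}^n\times\mathbb{R})$ for some $\epsilon>0$" means $u\in C^{2\alpha,\alpha}_{x,t,\mathrm{loc}}(\mathbb{R}^n\times\mathbb{R})$ for some $\alpha>s$. A classical (entire) solution is a function $u\in C^{2s+\epsilon,s+\epsilon}_{x,t,\mathrm{loc}}(\mathbb{R}^n\times\mathbb{R})\cap\mathcal{L}(\mathbb{R}^n\times\mathbb{R})$ for some $\epsilon>0$ satisfying the equation at every point of $\mathbb{R}^n\times\mathbb{R}$. Positive means $u>0$ everywhere; bounded means $\sup_{\mathbb{R}^n\times\mathbb{R}}u<\infty$. *)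

theory Defs
  imports "HOL-Analysis.Analysis"
begin

text \<open>
  Space-time functions are curried, \<open>u x t\<close> with \<open>x :: real ^ 'n\<close>, so that \<open>n = CARD('n)\<close>.
\<close>

text \<open>
  Cauchy principal value at \<open>a\<close>: the balls about \<open>a\<close> are removed and shrunk.
\<close>

definition has_pv_integral ::
  "(real ^ 'n \<Rightarrow> real) \<Rightarrow> real \<Rightarrow> real ^ 'n \<Rightarrow> bool" where
  "has_pv_integral f I a \<longleftrightarrow>
     (\<forall>\<epsilon>>0. set_integrable lebesgue (- ball a \<epsilon>) f) \<and>
     ((\<lambda>\<epsilon>. LINT y:(- ball a \<epsilon>)|lebesgue. f y) \<longlongrightarrow> I) (at_right 0)"

definition master_const :: "'n::finite itself \<Rightarrow> real \<Rightarrow> real" where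
  "master_const _ s = 1 / ((4 * pi) powr (real CARD('n) / 2) * \<bar>Gamma (- s)\<bar>)"

definition master_integrand ::
  "real \<Rightarrow> (real ^ 'n \<Rightarrow> real \<Rightarrow> real) \<Rightarrow> real ^ 'n \<Rightarrow> real \<Rightarrow> real ^ 'n \<Rightarrow> real \<Rightarrow> real" where
  "master_integrand s u x t y \<tau> =
     (u x t - u y \<tau>) / (t - \<tau>) powr (real CARD('n) / 2 + 1 + s)
       * exp (- (norm (x - y))\<^sup>2 / (4 * (t - \<tau>)))"

text \<open>
  \<open>has_master_value s u x t v\<close>: the iterated integral defining \<open>(\<partial>\<^sub>t - \<Delta>)\<^sup>s u (x, t)\<close> converges and
  the operator has the value \<open>v\<close> there. A relation is used because library integrals and limits
  are total, with arbitrary values in case of divergence.  The order of integration matters: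
  for \<open>s \<ge> 1/2\<close> the integrand is in general not absolutely integrable jointly in \<open>(y, \<tau>)\<close>.
\<close>

definition has_master_value ::
  "real \<Rightarrow> (real ^ 'n \<Rightarrow> real \<Rightarrow> real) \<Rightarrow> real ^ 'n \<Rightarrow> real \<Rightarrow> real \<Rightarrow> bool" where
  "has_master_value s u x t v \<longleftrightarrow>
     (\<exists>J :: real \<Rightarrow> real.
        (AE \<tau> in lebesgue. \<tau> < t \<longrightarrow>
            has_pv_integral (\<lambda>y. master_integrand s u x t y \<tau>) (J \<tau>) x) \<and>
        set_integrable lebesgue {..<t} J \<and>
        v = master_const TYPE('n) s * (LINT \<tau>:{..<t}|lebesgue. J \<tau>))"

definition locally_L1 :: "(real ^ 'n \<Rightarrow> real \<Rightarrow> real) \<Rightarrow> bool" where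
  "locally_L1 u \<longleftrightarrow>
     (\<forall>K :: ((real ^ 'n) \<times> real) set. compact K \<longrightarrow> (\<lambda>(x, t). u x t) absolutely_integrable_on K)"

definition master_space :: "real \<Rightarrow> (real ^ 'n \<Rightarrow> real \<Rightarrow> real) set" where
  "master_space s =
     {u. locally_L1 u \<and>
         (\<forall>t. (\<integral>\<^sup>+ \<tau> \<in> {..<t}.
                 (\<integral>\<^sup>+ x. ennreal (\<bar>u x \<tau>\<bar> * exp (- (norm x)\<^sup>2 / (4 * (t - \<tau>)))
                    / (1 + (t - \<tau>) powr (real CARD('n) / 2 + 1 + s))) \<partial>lebesgue)
               \<partial>lebesgue) < \<infinity>)}"

text \<open>
  \<open>parabolic_holder_loc \<alpha> u\<close> means that \<open>u\<close> is in \<open>C\<^sup>2\<^sup>\<alpha>\<^sup>,\<^sup>\<alpha>\<close> in \<open>(x, t)\<close> locally.  The derivatives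
  exist everywhere, and there is a Hoelder constant on each bounded subset of space-time.
  \<open>G\<close> is the spatial gradient, \<open>H\<close> the spatial Hessian matrix, \<open>v\<close> the time derivative.  The three
  rules cover disjoint ranges of \<open>\<alpha>\<close>, so that for each \<open>\<alpha>\<close> only one of them applies.
\<close>

inductive parabolic_holder_loc :: "real \<Rightarrow> (real ^ 'n \<Rightarrow> real \<Rightarrow> real) \<Rightarrow> bool" where
  low: "parabolic_holder_loc \<alpha> u"
    if "0 < \<alpha>" "\<alpha> \<le> 1/2"
      "\<And>S. bounded S \<Longrightarrow>
         \<exists>C>0. \<forall>(x, t)\<in>S. \<forall>(y, \<tau>)\<in>S.
           \<bar>u x t - u y \<tau>\<bar> \<le> C * (norm (x - y) + \<bar>t - \<tau>\<bar> powr (1/2)) powr (2 * \<alpha>)"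
| mid: "parabolic_holder_loc \<alpha> u"
    if "1/2 < \<alpha>" "\<alpha> \<le> 1"
      "\<And>S. bounded S \<Longrightarrow>
         \<exists>C>0. \<forall>x t \<tau>. (x, t) \<in> S \<longrightarrow> (x, \<tau>) \<in> S \<longrightarrow>
           \<bar>u x t - u x \<tau>\<bar> \<le> C * \<bar>t - \<tau>\<bar> powr \<alpha>"
      "\<And>x t. GDERIV (\<lambda>z. u z t) x :> G x t"
      "\<And>S. bounded S \<Longrightarrow>
         \<exists>C>0. \<forall>x y t. (x, t) \<in> S \<longrightarrow> (y, t) \<in> S \<longrightarrow>
           norm (G x t - G y t) \<le> C * norm (x - y) powr (2 * \<alpha> - 1)"
      "\<And>S. bounded S \<Longrightarrow>
         \<exists>C>0. \<forall>x t \<tau>. (x, t) \<in> S \<longrightarrow> (x, \<tau>) \<in> S \<longrightarrow>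
           norm (G x t - G x \<tau>) \<le> C * \<bar>t - \<tau>\<bar> powr (\<alpha> - 1/2)"
| high: "parabolic_holder_loc \<alpha> u"
    if "1 < \<alpha>"
      "\<And>x t. ((\<lambda>\<tau>. u x \<tau>) has_real_derivative v x t) (at t)"
      "\<And>x t. GDERIV (\<lambda>z. u z t) x :> G x t"
      "\<And>x t. ((\<lambda>z. G z t) has_derivative (\<lambda>h. H x t *v h)) (at x)"
      "parabolic_holder_loc (\<alpha> - 1) v"
      "\<And>i j. parabolic_holder_loc (\<alpha> - 1) (\<lambda>x t. H x t $ i $ j)"

text \<open>
  Classical entire solutions of \<open>(\<partial>\<^sub>t - \<Delta>)\<^sup>s u = F\<close>; in the applications \<open>F\<close> depends on \<open>u\<close>.
\<close>

definition classical_solution ::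
  "real \<Rightarrow> (real ^ 'n \<Rightarrow> real \<Rightarrow> real) \<Rightarrow> (real ^ 'n \<Rightarrow> real \<Rightarrow> real) \<Rightarrow> bool" where
  "classical_solution s F u \<longleftrightarrow>
     (\<exists>\<alpha>>s. parabolic_holder_loc \<alpha> u) \<and> u \<in> master_space s \<and>
     (\<forall>x t. has_master_value s u x t (F x t))"

end

(*
The operator is turned into a multiple of the integral over \<theta> > 0 of
\<theta>^(-1-s) (u - P_\<theta> u)(x,t), where P_\<theta> u(x,t) = E u(x + sqrt \<theta> Z, t - \<theta>) for a Gaussian Z. At a
maximum of f - A psi over the past, with psi = min 1 (|y - x0|^2 + t0 - \<tau>), one has
f - P_\<theta> f \<ge> - A min 1 (C \<theta>); this replaces attained maxima of the bounded functions f below.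

Moving planes: let v be the reflection of u in {x_1 = l} and w = u - v on {x_1 < l}. If w has positive
supremum m, then at an approximate maximum point, at distance d from the plane,
antisymmetry improves the estimate to
  m (c d^(-2s) - C \<epsilon>) \<le> x_1 (u^p - v^p) - 2 d v^p.
This is impossible for x_1 \<le> 0. For 0 < x_1 < l it is impossible if w is small there: the left-hand
side wins when d or v is small, the last term wins otherwise. So for l in a bounded range either
w \<le> 0, or w exceeds a fixed \<eta> somewhere in the strip 0 < x_1 < l. A uniform one-sided modulus of
continuity in x_1 allows the plane to advance by a fixed step from l \<le> 0, and u is increasing in x_1.
Then u is bounded below by some c > 0 near the points (R,0,...,0), and a penalised minimum there gives
R c^p \<le> const for all R, a contradiction.
*)
theory Submission
  imports Defs "HOL-Probability.Probability"
begin

text \<open>A bounded \<open>u\<close> need not attain its extrema, and passing to limits of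
  translates would require compactness of solutions and alter the coefficient x_1. All constants are
  therefore explicit and uniform in position and time. A penalty of height A costs a multiple of A
  in the operator. From a point whose value misses m by at most \<epsilon> m, A = 2 \<epsilon> m
  suffices and the cost is a small correction. Elsewhere the crude height A = M is used, and another
  quantity is made large against it: \<rho>^(-s) for the modulus, R at the end. The power d^(-2s)
  comes from integrating \<theta>^(-1-s) over \<theta> \<ge> d^2, the times at which the plane is at
  most one Gaussian length away. The modulus comes from smoothing: for \<theta> \<ge> \<rho>
  averages at points h apart differ by O(h / sqrt \<rho>), so a drop of u by more than \<eta> would
  leave a term of size \<eta> \<rho>^(-s) in the difference of two equations, whose right-hand side
  is bounded above near the strip.\<close>

section \<open>The Gaussian probability measure and its moments\<close>

lemma integrable_exp_neg_norm_sq: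
  fixes c :: real
  assumes c: "0 < c"
  shows "integrable lborel (\<lambda>z::'a::euclidean_space. exp (- c * (norm z)\<^sup>2))"
proof (rule integrableI_nonneg)
  have one: "integrable lborel (\<lambda>x::real. exp (- c * x\<^sup>2))"
  proof -
    define \<sigma> where "\<sigma> = sqrt (1 / (2 * c))"
    have s2: "2 * \<sigma>\<^sup>2 = 1 / c" using c by (simp add: \<sigma>_def)
    have s0: "0 < \<sigma>" using c by (simp add: \<sigma>_def)
    have "integrable lborel (\<lambda>x. sqrt (2 * pi * \<sigma>\<^sup>2) * normal_density 0 \<sigma> x)"
      using s0 by (intro integrable_mult_right) auto
    moreover have "sqrt (2 * pi * \<sigma>\<^sup>2) * normal_density 0 \<sigma> x = exp (- c * x\<^sup>2)" for x
      using s0 s2 by (simp add: normal_density_def)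
    ultimately show ?thesis by simp
  qed
  have "(\<integral>\<^sup>+z. ennreal (exp (- c * (norm z)\<^sup>2)) \<partial>(lborel :: 'a measure))
      = (\<integral>\<^sup>+z. (\<Prod>b\<in>Basis. ennreal (exp (- c * (z \<bullet> b)\<^sup>2))) \<partial>(lborel :: 'a measure))"
  proof (intro nn_integral_cong)
    fix z :: 'a
    have "(norm z)\<^sup>2 = (\<Sum>b\<in>Basis. (z \<bullet> b)\<^sup>2)"
      unfolding power2_norm_eq_inner by (subst euclidean_inner) (simp add: power2_eq_square)
    then show "ennreal (exp (- c * (norm z)\<^sup>2)) = (\<Prod>b\<in>Basis. ennreal (exp (- c * (z \<bullet> b)\<^sup>2)))"
      by (simp add: prod_ennreal exp_sum [symmetric] sum_distrib_left sum_negf)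
  qed
  also have "\<dots> = (\<Prod>b\<in>(Basis :: 'a set). \<integral>\<^sup>+x. ennreal (exp (- c * x\<^sup>2)) \<partial>(lborel :: real measure))"
    by (subst nn_integral_lborel_prod [symmetric]) auto
  also have "\<dots> < \<infinity>"
  proof -
    have "(\<integral>\<^sup>+x. ennreal (exp (- c * x\<^sup>2)) \<partial>(lborel :: real measure)) < \<infinity>"
      using one unfolding integrable_iff_bounded by simp
    then show ?thesis by (simp add: less_top [symmetric] power_eq_top_ennreal)
  qed
  finally show "(\<integral>\<^sup>+z. ennreal (exp (- c * (norm z)\<^sup>2)) \<partial>(lborel :: 'a measure)) < \<infinity>" .
qed auto

text \<open>Equals (4 pi)^(n/2). It is kept as an integral, since only its sign enters the
  estimates.\<close>

definition heat_mass :: "'a::euclidean_space itself \<Rightarrow> real" where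
  "heat_mass _ = (\<integral>(z::'a). exp (- (norm z)\<^sup>2 / 4) \<partial>lborel)"

definition heat_density :: "'a::euclidean_space \<Rightarrow> real" where
  "heat_density z = exp (- (norm z)\<^sup>2 / 4) / heat_mass TYPE('a)"

text \<open>The law of a centred Gaussian Z with covariance twice the identity, so that x + sqrt
  \<theta> Z has the heat kernel at time \<theta> as its density.\<close>

definition heat_prob :: "'a::euclidean_space measure" where
  "heat_prob = density lborel (\<lambda>z. ennreal (heat_density z))"

lemma integrable_exp_heat: "integrable lborel (\<lambda>z::'a::euclidean_space. exp (- (norm z)\<^sup>2 / 4))"
  using integrable_exp_neg_norm_sq [of "1/4", where 'a = 'a] by (simp add: field_simps)

lemma heat_mass_pos: "0 < heat_mass TYPE('a::euclidean_space)"
proof -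
  have "heat_mass TYPE('a) \<noteq> 0"
  proof
    assume "heat_mass TYPE('a) = 0"
    then have "AE z in (lborel :: 'a measure). exp (- (norm z)\<^sup>2 / 4) = 0"
      unfolding heat_mass_def by (subst (asm) integral_nonneg_eq_0_iff_AE [OF integrable_exp_heat]) auto
    then have "AE z in (lborel :: 'a measure). False" by simp
    then show False
      by (simp add: eventually_False ae_filter_eq_bot_iff)
  qed
  moreover have "0 \<le> heat_mass TYPE('a)" unfolding heat_mass_def by simp
  ultimately show ?thesis by simp
qed

lemma heat_density_pos: "0 < heat_density z"
  unfolding heat_density_def by (intro divide_pos_pos exp_gt_zero heat_mass_pos)

lemma heat_density_nonneg [simp]: "0 \<le> heat_density z"
  using heat_density_pos less_imp_le by blast

lemma measurable_heat_density [measurable]: "heat_density \<in> borel_measurable borel"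
  unfolding heat_density_def by measurable

lemma integrable_heat_density: "integrable lborel (heat_density :: 'a::euclidean_space \<Rightarrow> real)"
  unfolding heat_density_def [abs_def] by (intro integrable_divide integrable_exp_heat)

lemma integral_heat_density: "(\<integral>(z::'a::euclidean_space). heat_density z \<partial>lborel) = 1"
  using heat_mass_pos [where 'a = 'a] by (simp add: heat_density_def heat_mass_def)

lemma space_heat_prob [simp]: "space heat_prob = UNIV"
  and sets_heat_prob [simp, measurable_cong]: "sets heat_prob = sets borel"
  by (simp_all add: heat_prob_def)

lemma prob_space_heat_prob: "prob_space (heat_prob :: 'a::euclidean_space measure)"
proof
  have "emeasure (heat_prob :: 'a measure) (space heat_prob)
      = (\<integral>\<^sup>+z. ennreal (heat_density z) \<partial>(lborel :: 'a measure))"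
    by (simp add: heat_prob_def emeasure_density)
  also have "\<dots> = 1"
    using integral_heat_density [where 'a = 'a]
    by (subst nn_integral_eq_integral) (auto simp: integrable_heat_density)
  finally show "emeasure (heat_prob :: 'a measure) (space heat_prob) = 1" .
qed

interpretation heat_prob: prob_space "heat_prob :: 'a::euclidean_space measure"
  by (rule prob_space_heat_prob)

lemma integral_heat_prob:
  assumes "f \<in> borel_measurable borel"
  shows "(\<integral>z. f z \<partial>heat_prob) = (\<integral>z. heat_density z * f z \<partial>lborel)"
  unfolding heat_prob_def using assms by (subst integral_density) auto

lemma integrable_heat_prob_iff:
  assumes "f \<in> borel_measurable borel"
  shows "integrable heat_prob f \<longleftrightarrow> integrable lborel (\<lambda>z. heat_density z * f z)"
  unfolding heat_prob_def using assms by (subst integrable_density) auto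

lemma integrable_heat_prob_bounded:
  fixes f :: "'a::euclidean_space \<Rightarrow> real"
  assumes "f \<in> borel_measurable borel" "\<And>z. \<bar>f z\<bar> \<le> B"
  shows "integrable heat_prob f"
  using assms by (intro heat_prob.integrable_const_bound [where B = B]) auto

lemma integrable_norm_sq: "integrable heat_prob (\<lambda>z::'a::euclidean_space. (norm z)\<^sup>2)"
proof (subst integrable_heat_prob_iff, simp)
  show "integrable lborel (\<lambda>z::'a. heat_density z * (norm z)\<^sup>2)"
  proof (rule Bochner_Integration.integrable_bound)
    show "integrable lborel (\<lambda>z::'a. 8 / heat_mass TYPE('a) * exp (- (1/8) * (norm z)\<^sup>2))"
      by (intro integrable_mult_right integrable_exp_neg_norm_sq) simp
    show "AE z in lborel. norm (heat_density z * (norm (z::'a))\<^sup>2)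
        \<le> norm (8 / heat_mass TYPE('a) * exp (- (1/8) * (norm z)\<^sup>2))"
    proof (intro AE_I2)
      fix z :: 'a
      \<comment> \<open>Half of the Gaussian exponent absorbs the square: 8 r exp(-2r) \<le> 8
        exp(-r).\<close>
      define r where "r = (norm z)\<^sup>2 / 8"
      have "r \<le> exp r" using exp_ge_add_one_self [of r] by linarith
      then have "exp (- (2 * r)) * (8 * r) \<le> exp (- (2 * r)) * (8 * exp r)" by simp
      also have "\<dots> = 8 * exp (- r)" by (simp add: exp_add [symmetric])
      finally have "exp (- (norm z)\<^sup>2 / 4) * (norm z)\<^sup>2 \<le> 8 * exp (- (1/8) * (norm z)\<^sup>2)"
        by (simp add: r_def field_simps)
      then show "norm (heat_density z * (norm z)\<^sup>2)
        \<le> norm (8 / heat_mass TYPE('a) * exp (- (1/8) * (norm z)\<^sup>2))"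
        using heat_mass_pos [where 'a = 'a] by (simp add: heat_density_def divide_simps)
    qed
  qed simp
qed

definition heat_second_moment :: "'a::euclidean_space itself \<Rightarrow> real" where
  "heat_second_moment _ = (\<integral>(z::'a). (norm z)\<^sup>2 \<partial>heat_prob)"

lemma heat_second_moment_nonneg: "0 \<le> heat_second_moment TYPE('a::euclidean_space)"
  unfolding heat_second_moment_def by (simp add: integral_nonneg_AE)

lemma integrable_inner_heat: "integrable heat_prob (\<lambda>z::'a::euclidean_space. a \<bullet> z)"
proof (rule Bochner_Integration.integrable_bound)
  show "integrable heat_prob (\<lambda>z::'a. norm a * (1 + (norm z)\<^sup>2))"
    using integrable_norm_sq by auto
  show "AE z in heat_prob. norm (a \<bullet> z) \<le> norm (norm a * (1 + (norm z)\<^sup>2))"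
  proof (intro AE_I2)
    fix z :: 'a
    have "norm z \<le> 1 + (norm z)\<^sup>2"
      using zero_le_power2 [of "norm z - 1"] by (simp add: power2_diff) (use norm_ge_zero [of z] in linarith)
    then show "norm (a \<bullet> z) \<le> norm (norm a * (1 + (norm z)\<^sup>2))"
      using Cauchy_Schwarz_ineq2 [of a z] mult_left_mono [of "norm z" "1 + (norm z)\<^sup>2" "norm a"]
      by (simp add: abs_mult)
  qed
qed simp

lemma integral_lborel_uminus:
  fixes f :: "'a::euclidean_space \<Rightarrow> real"
  assumes [measurable]: "f \<in> borel_measurable borel"
  shows "(\<integral>z. f (- z) \<partial>lborel) = (\<integral>z. f z \<partial>lborel)"
  proof -
  have "(lborel :: 'a measure) = distr lborel borel uminus"
    using lborel_affine [of "-1" "0 :: 'a"] by (simp add: density_1)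
  then have "(\<integral>z. f z \<partial>lborel) = (\<integral>z. f z \<partial>distr lborel borel uminus)" by simp
  also have "\<dots> = (\<integral>z. f (- z) \<partial>lborel)" by (simp add: integral_distr)
  finally show ?thesis by simp
qed

lemma integral_inner_heat: "(\<integral>(z::'a::euclidean_space). a \<bullet> z \<partial>heat_prob) = 0"
proof -
  have "(\<integral>(z::'a). a \<bullet> z \<partial>heat_prob) = (\<integral>(z::'a). heat_density (- z) * (a \<bullet> (- z)) \<partial>lborel)"
    by (subst integral_lborel_uminus [where f = "\<lambda>z. heat_density z * (a \<bullet> z)"]) (simp_all add: integral_heat_prob)
  also have "\<dots> = - (\<integral>(z::'a). a \<bullet> z \<partial>heat_prob)"
    by (simp add: integral_heat_prob heat_density_def)
  finally show ?thesis by simp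
qed

section \<open>Reflections, Gaussian half-spaces and Gaussian shifts\<close>

definition reflect :: "'a::euclidean_space \<Rightarrow> real \<Rightarrow> 'a \<Rightarrow> 'a" where
  "reflect e l x = x + (2 * (l - x \<bullet> e)) *\<^sub>R e"

lemma measurable_reflect [measurable]: "reflect e l \<in> borel_measurable borel"
  unfolding reflect_def by measurable

lemma lborel_distr_reflect:
  assumes e: "e \<in> (Basis :: 'a::euclidean_space set)"
  shows "distr lborel borel (reflect e l) = lborel"
proof -
  \<comment> \<open>In coordinates the reflection is a diagonal affine map with entries 1 and -1, so
    the affine change of variables for \<open>lborel\<close> applies with Jacobian 1.\<close>
  define c where "c j = (if j = e then -1 else 1 :: real)" for j :: 'a
  have T: "(2 * l) *\<^sub>R e + (\<Sum>j\<in>Basis. (c j * (x \<bullet> j)) *\<^sub>R j) = reflect e l x" for x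
  proof (rule euclidean_eqI)
    fix b :: 'a assume b: "b \<in> Basis"
    have "(\<Sum>j\<in>Basis. (c j * (x \<bullet> j)) *\<^sub>R j) \<bullet> b = c b * (x \<bullet> b)"
      using b by simp
    then show "((2 * l) *\<^sub>R e + (\<Sum>j\<in>Basis. (c j * (x \<bullet> j)) *\<^sub>R j)) \<bullet> b = reflect e l x \<bullet> b"
      using b e by (cases "b = e") (auto simp: reflect_def inner_add_left c_def inner_not_same_Basis algebra_simps)
  qed
  have "(\<Prod>j\<in>(Basis::'a set). \<bar>c j\<bar>) = 1" by (rule prod.neutral) (simp add: c_def)
  then have "(lborel :: 'a measure) = density (distr lborel borel (reflect e l)) (\<lambda>_. 1)"
    using lborel_affine_euclidean [of c "(2 * l) *\<^sub>R e"] unfolding T by (simp add: c_def split: if_splits)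
  then show ?thesis
    by (simp add: density_1)
qed

lemma integral_lborel_reflect:
  fixes f :: "'a::euclidean_space \<Rightarrow> real"
  assumes e: "e \<in> Basis" and [measurable]: "f \<in> borel_measurable borel"
  shows "(\<integral>z. f (reflect e l z) \<partial>lborel) = (\<integral>z. f z \<partial>lborel)"
  by (subst (2) lborel_distr_reflect [OF e, symmetric]) (simp add: integral_distr)

lemma norm_reflect_0: "e \<in> Basis \<Longrightarrow> norm (reflect e 0 z) = norm z"
  by (simp add: norm_eq_sqrt_inner reflect_def inner_add_left inner_add_right inner_commute inner_Basis algebra_simps)

lemma reflect_reflect [simp]: "e \<in> Basis \<Longrightarrow> reflect e l (reflect e l x) = x"
  by (simp add: reflect_def inner_add_left algebra_simps)

lemma inner_reflect [simp]: "e \<in> Basis \<Longrightarrow> reflect e l x \<bullet> e = 2 * l - x \<bullet> e"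
  by (simp add: reflect_def inner_add_left)

lemma integral_heat_prob_reflect_0:
  fixes f :: "'a::euclidean_space \<Rightarrow> real"
  assumes e: "e \<in> Basis" and [measurable]: "f \<in> borel_measurable borel"
  shows "(\<integral>z. f (reflect e 0 z) \<partial>heat_prob) = (\<integral>z. f z \<partial>heat_prob)"
  using integral_lborel_reflect [OF e, of "\<lambda>z. heat_density z * f z" 0]
  by (simp add: integral_heat_prob heat_density_def norm_reflect_0 e)

lemma norm_reflect_sq:
  assumes "e \<in> Basis"
  shows "(norm (reflect e l z))\<^sup>2 = (norm z)\<^sup>2 + 4 * l * (l - z \<bullet> e)"
  using assms by (simp add: reflect_def power2_norm_eq_inner inner_add_left inner_add_right inner_diff_left inner_diff_right inner_commute algebra_simps)

lemma heat_density_mono: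
  fixes z w :: "'a::euclidean_space"
  shows "norm z \<le> norm w \<Longrightarrow> heat_density w \<le> heat_density z"
  unfolding heat_density_def
  by (intro divide_right_mono less_imp_le [OF heat_mass_pos]) (simp add: power_mono)

lemma measure_heat_prob:
  assumes "A \<in> sets borel"
  shows "measure heat_prob A = (\<integral>z. heat_density z * indicator A z \<partial>lborel)"
proof -
  have "measure heat_prob A = (\<integral>z. indicator A z \<partial>heat_prob)" by simp
  also have "\<dots> = (\<integral>z. heat_density z * indicator A z \<partial>lborel)"
    using assms by (intro integral_heat_prob) auto
  finally show ?thesis .
qed

text \<open>The source of the improvement by antisymmetry. \<open>F\<close> will be a barrier minus
  an antisymmetric function: non-negative on the near side, of unknown sign on the far side, but
  controlled in sum over a mirror pair. As \<open>0 < l\<close>, the Gaussian centre lies on the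
  near side, so every pair contributes at least \<open>2 * b\<close> times the smaller of its two
  weights.\<close>

lemma integral_reflection_lower:
  fixes F :: "'a::euclidean_space \<Rightarrow> real"
  assumes e: "e \<in> Basis" and [measurable]: "F \<in> borel_measurable borel" and bd: "\<And>z. \<bar>F z\<bar> \<le> B"
    and l: "0 < l" and b: "0 \<le> b"
    and half: "\<And>z. z \<bullet> e \<le> l \<Longrightarrow> 0 \<le> F z"
    and pair: "\<And>z. 2 * b \<le> F z + F (reflect e l z)"
  shows "b * measure heat_prob {z. z \<bullet> e > l} \<le> (\<integral>z. F z \<partial>heat_prob)"
proof -
  let ?g = "heat_density :: 'a \<Rightarrow> real" and ?R = "reflect e l :: 'a \<Rightarrow> 'a"
  let ?i = "indicator {z. z \<bullet> e > l} :: 'a \<Rightarrow> real"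
  have intF: "integrable lborel (\<lambda>z. ?g z * F z)"
    using integrable_heat_prob_bounded [of F B] bd by (simp add: integrable_heat_prob_iff)
  have inti: "integrable lborel (\<lambda>z. ?g z * ?i z)"
    using integrable_heat_prob_bounded [of ?i 1] by (simp add: integrable_heat_prob_iff indicator_def)
  have "integrable (distr lborel borel ?R) (\<lambda>z. ?g z * F z)"
    using intF by (simp add: lborel_distr_reflect [OF e])
  then have intFR: "integrable lborel (\<lambda>z. ?g (?R z) * F (?R z))"
    by (simp add: integrable_distr_eq)
  \<comment> \<open>Each point is averaged with its mirror image; the weight is larger at the one with \<open>z \<bullet> e \<le> l\<close>.\<close>
  have pw: "2 * b * (?g z * ?i z) \<le> ?g z * F z + ?g (?R z) * F (?R z)" for z
  proof -
    have key: "2 * b * ?g w' \<le> ?g w * F w + ?g w' * F w'" "0 \<le> ?g w * F w + ?g w' * F w'"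
      if w: "w \<bullet> e \<le> l" and w': "w' = ?R w" for w w'
    proof -
      have "(norm w)\<^sup>2 \<le> (norm w')\<^sup>2" using l w e by (simp add: w' norm_reflect_sq)
      then have "?g w' \<le> ?g w" by (intro heat_density_mono) (simp add: power2_le_iff_abs_le)
      then have "?g w' * F w \<le> ?g w * F w" using half [OF w] by (rule mult_right_mono)
      moreover have "?g w' * (2 * b) \<le> ?g w' * (F w + F w')"
        using pair [of w] by (intro mult_left_mono) (simp_all add: w')
      ultimately show 1: "2 * b * ?g w' \<le> ?g w * F w + ?g w' * F w'" by (simp add: algebra_simps)
      have "0 \<le> 2 * b * ?g w'" using b by simp
      with 1 show "0 \<le> ?g w * F w + ?g w' * F w'" by linarith
    qed
    show ?thesis
    proof (cases "z \<bullet> e \<le> l")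
      case True
      then show ?thesis using key(2) [of z "?R z"] by simp
    next
      case False
      then show ?thesis using key(1) [of "?R z" z] e by (simp add: add.commute)
    qed
  qed
  have "2 * (b * (\<integral>z. ?g z * ?i z \<partial>lborel)) = (\<integral>z. 2 * b * (?g z * ?i z) \<partial>lborel)" by simp
  also have "\<dots> \<le> (\<integral>z. ?g z * F z + ?g (?R z) * F (?R z) \<partial>lborel)"
    using inti intF intFR pw by (intro integral_mono) auto
  also have "\<dots> = (\<integral>z. ?g z * F z \<partial>lborel) + (\<integral>z. ?g z * F z \<partial>lborel)"
    using intF intFR integral_lborel_reflect [OF e, of "\<lambda>z. ?g z * F z" l] by simp
  finally show ?thesis by (simp add: integral_heat_prob measure_heat_prob)
qed

lemma heat_tail_pos:
  assumes e: "e \<in> (Basis :: 'a::euclidean_space set)"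
  shows "0 < measure heat_prob {z::'a. z \<bullet> e > 1}"
proof -
  let ?S = "{z::'a. z \<bullet> e > 1}"
  have op: "open ?S" by (intro open_Collect_less continuous_intros)
  have "2 *\<^sub>R e \<in> ?S" using e by simp
  then have ne: "?S \<noteq> {}" by blast
  let ?f = "\<lambda>z. heat_density z * indicator ?S z :: real"
  have int: "integrable lborel ?f"
    using integrable_heat_prob_bounded [of "indicator ?S :: 'a \<Rightarrow> real" 1] op
    by (simp add: integrable_heat_prob_iff indicator_def)
  have "(\<integral>z. ?f z \<partial>lborel) \<noteq> 0"
  proof
    assume "(\<integral>z. ?f z \<partial>lborel) = 0"
    then have "AE z in lborel. ?f z = 0"
      using int by (subst (asm) integral_nonneg_eq_0_iff_AE) auto
    then have "AE z in lborel. z \<notin> ?S"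
      using less_imp_neq [OF heat_density_pos] by (auto simp: indicator_def split: if_splits)
    then have "?S \<in> null_sets lborel"
      using op by (subst (asm) AE_iff_null_sets [symmetric]) auto
    then have "negligible ?S"
      by (simp add: negligible_iff_null_sets null_sets_completionI)
    then show False using open_not_negligible [OF op ne] by blast
  qed
  moreover have "0 \<le> (\<integral>z. ?f z \<partial>lborel)" by simp
  ultimately show ?thesis using op by (simp add: measure_heat_prob less_le)
qed

lemma heat_tail_antimono:
  assumes "l \<le> (1::real)"
  shows "measure heat_prob {z::'a::euclidean_space. z \<bullet> e > 1}
    \<le> measure heat_prob {z. z \<bullet> e > l}"
  using assms
  by (intro heat_prob.finite_measure_mono) auto

text \<open>The shift is moved from \<open>f\<close> to the density, so boundedness of
  \<open>f\<close> is enough for a modulus of continuity. Pointwise the loss is (1 - E) f with E the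
  ratio of the shifted to the original density, and 1 + x \<le> exp x bounds 1 - E by a polynomial
  whose Gaussian average is the stated constant.\<close>

lemma heat_shift:
  fixes f :: "'a::euclidean_space \<Rightarrow> real"
  assumes [measurable]: "f \<in> borel_measurable borel" and f: "\<And>z. 0 \<le> f z" "\<And>z. f z \<le> M"
  shows "(\<integral>z. f z - f (z + a) \<partial>heat_prob)
    \<le> M * (norm a * (1 + heat_second_moment TYPE('a)) + (norm a)\<^sup>2)"
proof -
  let ?g = "heat_density :: 'a \<Rightarrow> real"
  have M: "0 \<le> M" using f [of 0] by linarith
  have bd: "\<bar>f z\<bar> \<le> M" for z using f [of z] by linarith
  have int: "integrable lborel (\<lambda>z. ?g z * f z)" "integrable lborel (\<lambda>z. ?g z * f (z + a))"
    using integrable_heat_prob_bounded [of f M] integrable_heat_prob_bounded [of "\<lambda>z. f (z + a)" M] bd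
    by (simp_all add: integrable_heat_prob_iff)
  have "integrable (distr lborel borel ((+) (- a))) (\<lambda>z. ?g z * f (z + a))"
    using int(2) by (simp add: lborel_distr_plus)
  then have int2: "integrable lborel (\<lambda>z. ?g (z - a) * f z)"
    by (simp add: integrable_distr_eq)
  have "(\<integral>z. ?g z * f (z + a) \<partial>lborel) = (\<integral>z. ?g z * f (z + a) \<partial>distr lborel borel ((+) (- a)))"
    by (simp add: lborel_distr_plus)
  also have "\<dots> = (\<integral>z. ?g (z - a) * f z \<partial>lborel)"
    by (simp add: integral_distr)
  finally have shift: "(\<integral>z. ?g z * f (z + a) \<partial>lborel) = (\<integral>z. ?g (z - a) * f z \<partial>lborel)" .
  have int3: "integrable lborel (\<lambda>z. ?g z * (M * (norm a * (1 + (norm z)\<^sup>2) + (norm a)\<^sup>2)))"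
  proof -
    have "integrable heat_prob (\<lambda>z::'a. M * (norm a * (1 + (norm z)\<^sup>2) + (norm a)\<^sup>2))"
      using integrable_norm_sq [where 'a = 'a] by auto
    then show ?thesis by (subst (asm) integrable_heat_prob_iff) auto
  qed
  have pw: "?g z * f z - ?g (z - a) * f z \<le> ?g z * (M * (norm a * (1 + (norm z)\<^sup>2) + (norm a)\<^sup>2))" for z
  proof -
    \<comment> \<open>Expanding |z - a|^2 in the exponent leaves exactly this factor.\<close>
    define E where "E = exp ((2 * (z \<bullet> a) - (norm a)\<^sup>2) / 4)"
    have g: "?g (z - a) = ?g z * E"
      unfolding heat_density_def E_def times_divide_eq_left exp_add [symmetric]
      by (simp add: power2_norm_eq_inner inner_diff_left inner_diff_right inner_commute algebra_simps add_divide_distrib diff_divide_distrib)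
    have "1 - E \<le> - ((2 * (z \<bullet> a) - (norm a)\<^sup>2) / 4)"
      unfolding E_def using exp_ge_add_one_self [of "(2 * (z \<bullet> a) - (norm a)\<^sup>2) / 4"] by linarith
    also have "\<dots> \<le> (2 * (norm z * norm a) + (norm a)\<^sup>2) / 4"
      using Cauchy_Schwarz_ineq2 [of z a] by (simp add: field_simps)
    also have "\<dots> \<le> norm a * (1 + (norm z)\<^sup>2) + (norm a)\<^sup>2"
    proof -
      have "2 * norm z \<le> 1 + (norm z)\<^sup>2"
        using zero_le_power2 [of "norm z - 1"] by (simp add: power2_diff)
      then have "norm a * (2 * norm z) \<le> norm a * (1 + (norm z)\<^sup>2)" by (intro mult_left_mono) auto
      moreover have "0 \<le> norm a * (2 * norm z)" by simp
      ultimately have "norm a * (2 * norm z) / 4 \<le> norm a * (1 + (norm z)\<^sup>2)" by linarith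
      then have "2 * (norm z * norm a) / 4 \<le> norm a * (1 + (norm z)\<^sup>2)" by (simp add: mult.commute)
      moreover have "(norm a)\<^sup>2 / 4 \<le> (norm a)\<^sup>2" by simp
      ultimately show ?thesis unfolding add_divide_distrib by linarith
    qed
    finally have 1: "1 - E \<le> norm a * (1 + (norm z)\<^sup>2) + (norm a)\<^sup>2" (is "_ \<le> ?K") .
    have "(1 - E) * f z \<le> ?K * f z" using 1 f by (intro mult_right_mono) auto
    also have "\<dots> \<le> ?K * M" using f by (intro mult_left_mono) auto
    finally have "?g z * ((1 - E) * f z) \<le> ?g z * (?K * M)" by (intro mult_left_mono) auto
    then show ?thesis by (simp add: g algebra_simps)
  qed
  have "(\<integral>z. f z - f (z + a) \<partial>heat_prob) = (\<integral>z. ?g z * f z - ?g (z - a) * f z \<partial>lborel)"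
    using int int2 by (subst integral_heat_prob) (simp_all add: right_diff_distrib shift)
  also have "\<dots> \<le> (\<integral>z. ?g z * (M * (norm a * (1 + (norm z)\<^sup>2) + (norm a)\<^sup>2)) \<partial>lborel)"
    using int int2 int3 pw by (intro integral_mono) auto
  also have "\<dots> = (\<integral>(z::'a). M * (norm a * (1 + (norm z)\<^sup>2) + (norm a)\<^sup>2) \<partial>heat_prob)"
    by (subst integral_heat_prob) auto
  also have "\<dots> = M * (norm a * (1 + heat_second_moment TYPE('a)) + (norm a)\<^sup>2)"
    using integrable_norm_sq [where 'a = 'a]
    by (simp add: heat_second_moment_def heat_prob.prob_space [simplified])
  finally show ?thesis .
qed

section \<open>The operator as an integral of heat averages over elapsed time\<close>

definition heat_avg :: "('a::euclidean_space \<Rightarrow> real \<Rightarrow> real) \<Rightarrow> 'a \<Rightarrow> real \<Rightarrow> real \<Rightarrow> real" where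
  "heat_avg u x t \<theta> = (\<integral>z. u (x + sqrt \<theta> *\<^sub>R z) (t - \<theta>) \<partial>heat_prob)"

text \<open>Dominated convergence along the radii 1/(n+1), with \<open>f\<close> itself as majorant.
  At a fixed \<tau> < t and for bounded \<open>u\<close> the integrand is absolutely integrable in
  y, so the principal value is an ordinary integral.\<close>

lemma has_pv_integral_unique_integrable:
  assumes "has_pv_integral f I a" and f: "integrable lebesgue f"
  shows "I = (\<integral>y. f y \<partial>lebesgue)"
proof -
  have lim: "((\<lambda>\<epsilon>. LINT y:(- ball a \<epsilon>)|lebesgue. f y) \<longlongrightarrow> I) (at_right 0)"
    using assms by (simp add: has_pv_integral_def)
  have "filterlim (\<lambda>n. inverse (real (Suc n))) (at_right 0) sequentially"
    using LIMSEQ_inverse_real_of_nat by (auto simp: filterlim_at)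
  with lim have 1: "(\<lambda>n. LINT y:(- ball a (inverse (real (Suc n))))|lebesgue. f y) \<longlonglongrightarrow> I"
    by (rule filterlim_compose)
  have 2: "(\<lambda>n. LINT y:(- ball a (inverse (real (Suc n))))|lebesgue. f y) \<longlonglongrightarrow> (\<integral>y. f y \<partial>lebesgue)"
    unfolding set_lebesgue_integral_def
  proof (rule integral_dominated_convergence [where w = "\<lambda>y. \<bar>f y\<bar>"])
    have "AE y in lebesgue. y \<noteq> a"
      by (rule AE_I [where N = "{a}"]) (auto simp: null_sets_def)
    then show "AE y in lebesgue. (\<lambda>n. indicat_real (- ball a (inverse (real (Suc n)))) y *\<^sub>R f y) \<longlonglongrightarrow> f y"
    proof eventually_elim
      case (elim y)
      then have "0 < dist a y" by simp
      then have "eventually (\<lambda>n. inverse (real (Suc n)) < dist a y) sequentially"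
        using order_tendstoD(2) [OF LIMSEQ_inverse_real_of_nat] by blast
      then have "eventually (\<lambda>n. indicat_real (- ball a (inverse (real (Suc n)))) y *\<^sub>R f y = f y) sequentially"
        by eventually_elim (auto simp: indicator_def)
      then show ?case by (rule tendsto_eventually)
    qed
    show "AE y in lebesgue. norm (indicat_real (- ball a (inverse (real (Suc n)))) y *\<^sub>R f y) \<le> \<bar>f y\<bar>" for n
      by (auto simp: indicator_def)
    show "integrable lebesgue (\<lambda>y. \<bar>f y\<bar>)" using f by simp
    show "f \<in> borel_measurable lebesgue" using f by simp
    then show "(\<lambda>y. indicat_real (- ball a (inverse (real (Suc n)))) y *\<^sub>R f y) \<in> borel_measurable lebesgue" for n
      by (intro borel_measurable_scaleR borel_measurable_indicator) auto
  qed
  show ?thesis using LIMSEQ_unique [OF 1 2] .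
qed

text \<open>Substitute y = x + sqrt \<theta> z with \<theta> = t - \<tau>. The Jacobian
  \<theta>^(n/2) cancels the dimensional part of the kernel and leaves the weight
  \<theta>^(-1-s).\<close>

lemma master_integrand_integral:
  fixes u :: "real ^ 'n \<Rightarrow> real \<Rightarrow> real"
  assumes \<tau>: "\<tau> < t" and u [measurable]: "(\<lambda>y. u y \<tau>) \<in> borel_measurable borel" and bd: "\<And>y. \<bar>u y \<tau>\<bar> \<le> M"
  shows "integrable lebesgue (\<lambda>y. master_integrand s u x t y \<tau>)"
    and "(\<integral>y. master_integrand s u x t y \<tau> \<partial>lebesgue)
      = heat_mass TYPE(real ^ 'n) * ((t - \<tau>) powr (- 1 - s) * (u x t - heat_avg u x t (t - \<tau>)))"
proof -
  define \<theta> where "\<theta> = t - \<tau>"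
  define n where "n = real CARD('n)"
  define m where "m = heat_mass TYPE(real ^ 'n)"
  define F where "F y = master_integrand s u x t y \<tau>" for y
  have \<theta>: "0 < \<theta>" using \<tau> by (simp add: \<theta>_def)
  have m: "0 < m" unfolding m_def by (rule heat_mass_pos)
  have F [measurable]: "F \<in> borel_measurable borel"
    unfolding F_def master_integrand_def by measurable
  define G where "G z = u x t - u (x + sqrt \<theta> *\<^sub>R z) \<tau>" for z
  have G [measurable]: "G \<in> borel_measurable borel" unfolding G_def by measurable
  have bdG: "\<bar>G z\<bar> \<le> \<bar>u x t\<bar> + M" for z
    unfolding G_def using bd [of "x + sqrt \<theta> *\<^sub>R z"] by linarith
  have FG: "F (x + sqrt \<theta> *\<^sub>R z) = (m * \<theta> powr (- (n / 2) - 1 - s)) * (heat_density z * G z)" for z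
  proof -
    have "(norm (sqrt \<theta> *\<^sub>R z))\<^sup>2 / (4 * \<theta>) = (norm z)\<^sup>2 / 4"
      using \<theta> by (simp add: power_mult_distrib)
    moreover have "\<theta> powr (- (n / 2) - 1 - s) = 1 / \<theta> powr (n / 2 + 1 + s)"
      unfolding powr_minus_divide [symmetric] by (rule arg_cong [where f = "(powr) \<theta>"]) simp
    ultimately show ?thesis
      using m unfolding F_def G_def master_integrand_def heat_density_def n_def [symmetric] \<theta>_def [symmetric] m_def [symmetric]
      by (simp add: norm_minus_commute)
  qed
  have intG: "integrable heat_prob G" by (rule integrable_heat_prob_bounded [OF G bdG])
  then have intGl: "integrable lborel (\<lambda>z. heat_density z * G z)" by (simp add: integrable_heat_prob_iff)
  have aff: "(lborel :: (real ^ 'n) measure) = density (distr lborel borel (\<lambda>z. x + sqrt \<theta> *\<^sub>R z)) (\<lambda>_. ennreal (\<theta> powr (n / 2)))"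
  proof -
    have "sqrt \<theta> ^ CARD('n) = \<theta> powr (n / 2)"
      using \<theta> by (simp add: powr_realpow [symmetric] powr_half_sqrt [symmetric] powr_powr n_def)
    then show ?thesis
      using lborel_affine [of "sqrt \<theta>" x] \<theta> by (simp flip: ennreal_power)
  qed
  have intFl: "integrable lborel F"
    by (subst aff, subst integrable_density) (auto simp: integrable_distr_eq FG intro!: integrable_mult_right intGl)
  then show "integrable lebesgue (\<lambda>y. master_integrand s u x t y \<tau>)"
    unfolding F_def [symmetric] by (simp add: integrable_completion)
  have "(\<integral>y. F y \<partial>lebesgue) = (\<integral>y. F y \<partial>lborel)" by (simp add: integral_completion)
  also have "\<dots> = \<theta> powr (n / 2) * (m * \<theta> powr (- (n / 2) - 1 - s)) * (\<integral>z. heat_density z * G z \<partial>lborel)"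
    by (subst aff) (simp add: integral_density integral_distr FG)
  also have "\<theta> powr (n / 2) * (m * \<theta> powr (- (n / 2) - 1 - s)) = m * \<theta> powr (- 1 - s)"
  proof -
    have "\<theta> powr (n / 2) * \<theta> powr (- (n / 2) - 1 - s) = \<theta> powr (- 1 - s)"
      unfolding powr_add [symmetric] by simp
    then show ?thesis by simp
  qed
  also have "(\<integral>z. heat_density z * G z \<partial>lborel) = (\<integral>z. G z \<partial>heat_prob)"
    by (simp add: integral_heat_prob)
  also have "(\<integral>z. G z \<partial>heat_prob) = u x t - heat_avg u x t \<theta>"
    unfolding G_def heat_avg_def using integrable_heat_prob_bounded [of "\<lambda>z. u (x + sqrt \<theta> *\<^sub>R z) \<tau>" M] bd
    by (simp add: heat_prob.prob_space [simplified] \<theta>_def)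
  finally show "(\<integral>y. master_integrand s u x t y \<tau> \<partial>lebesgue)
      = heat_mass TYPE(real ^ 'n) * ((t - \<tau>) powr (- 1 - s) * (u x t - heat_avg u x t (t - \<tau>)))"
    by (simp add: F_def m_def \<theta>_def)
qed

text \<open>Equals 1 / |Gamma(-s)|: the powers of 4 pi in the two factors cancel.\<close>

definition master_rate :: "'n::finite itself \<Rightarrow> real \<Rightarrow> real" where
  "master_rate _ s = master_const TYPE('n) s * heat_mass TYPE(real ^ 'n)"

lemma master_rate_pos:
  assumes "0 < s" "s < 1"
  shows "0 < master_rate TYPE('n::finite) s"
proof -
  \<comment> \<open>\<open>Gamma\<close> takes the value 0 exactly at its poles, so it suffices that
    -s lies strictly between -1 and 0.\<close>
  have "- s \<notin> \<int>\<^sub>\<le>\<^sub>0"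
  proof
    assume "- s \<in> \<int>\<^sub>\<le>\<^sub>0"
    then obtain k :: int where "- s = of_int k" by (auto simp: nonpos_Ints_def)
    then have "-1 < real_of_int k" "real_of_int k < 0" using assms by linarith+
    then show False by simp
  qed
  then have "Gamma (- s) \<noteq> 0" by (simp add: Gamma_eq_zero_iff)
  then show ?thesis
    unfolding master_rate_def master_const_def by (intro mult_pos_pos divide_pos_pos heat_mass_pos) auto
qed

text \<open>\<open>J\<close> stays an abstract density because it already carries measurability and
  integrability in \<tau>; the heat averages are only identified with it almost everywhere.\<close>

lemma has_master_valueE:
  fixes u :: "real ^ 'n \<Rightarrow> real \<Rightarrow> real"
  assumes v: "has_master_value s u x t v"
    and u: "\<And>\<tau>. (\<lambda>y. u y \<tau>) \<in> borel_measurable borel" and bd: "\<And>y \<tau>. \<bar>u y \<tau>\<bar> \<le> M"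
  obtains J where "set_integrable lebesgue {..<t} J"
    and "AE \<tau> in lebesgue. \<tau> < t \<longrightarrow> J \<tau> = (t - \<tau>) powr (- 1 - s) * (u x t - heat_avg u x t (t - \<tau>))"
    and "v = master_rate TYPE('n) s * (LINT \<tau>:{..<t}|lebesgue. J \<tau>)"
proof -
  obtain J where J: "AE \<tau> in lebesgue. \<tau> < t \<longrightarrow> has_pv_integral (\<lambda>y. master_integrand s u x t y \<tau>) (J \<tau>) x"
    "set_integrable lebesgue {..<t} J" "v = master_const TYPE('n) s * (LINT \<tau>:{..<t}|lebesgue. J \<tau>)"
    using v by (auto simp: has_master_value_def)
  define m where "m = heat_mass TYPE(real ^ 'n)"
  have m: "0 < m" unfolding m_def by (rule heat_mass_pos)
  show thesis
  proof
    show "set_integrable lebesgue {..<t} (\<lambda>\<tau>. J \<tau> / m)"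
      using J(2) by simp
    show "AE \<tau> in lebesgue. \<tau> < t \<longrightarrow> J \<tau> / m = (t - \<tau>) powr (- 1 - s) * (u x t - heat_avg u x t (t - \<tau>))"
      using J(1)
    proof eventually_elim
      case (elim \<tau>)
      show ?case
      proof
        assume \<tau>: "\<tau> < t"
        have "J \<tau> = m * ((t - \<tau>) powr (- 1 - s) * (u x t - heat_avg u x t (t - \<tau>)))"
          using has_pv_integral_unique_integrable [OF elim [rule_format, OF \<tau>] master_integrand_integral(1) [OF \<tau> u bd]]
            master_integrand_integral(2) [OF \<tau> u bd, where s = s and x = x] by (simp add: m_def)
        then show "J \<tau> / m = (t - \<tau>) powr (- 1 - s) * (u x t - heat_avg u x t (t - \<tau>))"
          using m by simp
      qed
    qed
    show "v = master_rate TYPE('n) s * (LINT \<tau>:{..<t}|lebesgue. J \<tau> / m)"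
      using m by (simp add: J(3) master_rate_def m_def)
  qed
qed

section \<open>Integrals in elapsed time against the fractional weight\<close>

definition frac_const :: "real \<Rightarrow> real \<Rightarrow> real" where
  "frac_const s C = (\<integral>\<theta>. indicator {0<..} \<theta> * (\<theta> powr (- 1 - s) * min 1 (C * \<theta>)) \<partial>lborel)"

text \<open>Both arguments of the minimum matter. Near 0 the bound C \<theta> leaves \<theta>^(-s),
  integrable since s < 1; at infinity the bound 1 leaves \<theta>^(-1-s), integrable since s >
  0.\<close>

lemma integrable_frac_const:
  assumes s: "0 < s" "s < 1" and C: "0 \<le> C"
  shows "integrable lborel (\<lambda>\<theta>::real. indicator {0<..} \<theta> * (\<theta> powr (- 1 - s) * min 1 (C * \<theta>)))"
proof (rule Bochner_Integration.integrable_bound)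
  have 1: "integrable lborel (\<lambda>\<theta>::real. indicator {1..} \<theta> * \<theta> powr (- 1 - s))"
  proof -
    have "(\<lambda>\<theta>. \<theta> powr (- 1 - s)) integrable_on {1::real..}"
      using has_integral_powr_to_inf [of "-1-s" 1] s by (auto simp: integrable_on_def)
    then have "(\<lambda>\<theta>. \<theta> powr (- 1 - s)) absolutely_integrable_on {1::real..}"
      by (intro nonnegative_absolutely_integrable_1) auto
    then show ?thesis unfolding set_integrable_def by (simp add: integrable_completion)
  qed
  have 2: "integrable lborel (\<lambda>\<theta>::real. indicator {0..1} \<theta> * \<theta> powr (- s))"
  proof -
    have "(\<lambda>\<theta>. \<theta> powr (- s)) integrable_on {0..1::real}"
      using has_integral_powr_from_0 [of "-s" 1] s by (auto simp: integrable_on_def)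
    then have "(\<lambda>\<theta>. \<theta> powr (- s)) absolutely_integrable_on {0..1::real}"
      by (intro nonnegative_absolutely_integrable_1) auto
    then show ?thesis unfolding set_integrable_def by (simp add: integrable_completion)
  qed
  show "integrable lborel (\<lambda>\<theta>::real. indicator {1..} \<theta> * \<theta> powr (- 1 - s) + C * (indicator {0..1} \<theta> * \<theta> powr (- s)))"
    using 1 2 by auto
  show "AE \<theta> in lborel. norm (indicator {0<..} \<theta> * (\<theta> powr (- 1 - s) * min 1 (C * \<theta>)))
    \<le> norm (indicator {1..} \<theta> * \<theta> powr (- 1 - s) + C * (indicator {0..1} \<theta> * \<theta> powr (- s)))"
  proof (intro AE_I2)
    fix \<theta> :: real
    consider "\<theta> \<le> 0" | "0 < \<theta>" "\<theta> \<le> 1" | "1 < \<theta>" by linarith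
    then have "\<bar>indicator {0<..} \<theta> * (\<theta> powr (- 1 - s) * min 1 (C * \<theta>))\<bar>
      \<le> indicator {1..} \<theta> * \<theta> powr (- 1 - s) + C * (indicator {0..1} \<theta> * \<theta> powr (- s))"
    proof cases
      case 1
      then have "indicator {0<..} \<theta> = (0::real)" by simp
      then show ?thesis using C by simp
    next
      case 2
      have m: "0 \<le> min 1 (C * \<theta>)" using 2 C by simp
      have "\<theta> powr (- 1 - s) * min 1 (C * \<theta>) \<le> \<theta> powr (- 1 - s) * (C * \<theta>)"
        by (intro mult_left_mono) auto
      also have "\<dots> = C * \<theta> powr (- s)"
        using 2 powr_add [of \<theta> "-1-s" 1] by simp
      also have "\<dots> \<le> indicator {1..} \<theta> * \<theta> powr (- 1 - s) + C * (indicator {0..1} \<theta> * \<theta> powr (- s))"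
        using 2 by simp
      finally show ?thesis using 2 m by (simp add: abs_mult)
    next
      case 3
      have m: "0 \<le> min 1 (C * \<theta>)" using 3 C by simp
      have "\<theta> powr (- 1 - s) * min 1 (C * \<theta>) \<le> \<theta> powr (- 1 - s) * 1"
        by (intro mult_left_mono) auto
      also have "\<dots> \<le> indicator {1..} \<theta> * \<theta> powr (- 1 - s) + C * (indicator {0..1} \<theta> * \<theta> powr (- s))"
        using 3 by simp
      finally show ?thesis using 3 m by (simp add: abs_mult)
    qed
    then show "norm (indicator {0<..} \<theta> * (\<theta> powr (- 1 - s) * min 1 (C * \<theta>)))
      \<le> norm (indicator {1..} \<theta> * \<theta> powr (- 1 - s) + C * (indicator {0..1} \<theta> * \<theta> powr (- s)))"
      by simp
  qed
qed simp

lemma frac_const_nonneg: "0 \<le> C \<Longrightarrow> 0 \<le> frac_const s C"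
  unfolding frac_const_def by (intro integral_nonneg_AE AE_I2) (auto simp: indicator_def)

lemma integral_tail_powr:
  assumes s: "0 < (s::real)" and \<rho>: "0 < \<rho>"
  shows "integrable lborel (\<lambda>\<theta>::real. indicator {0<..} \<theta> * (\<theta> powr (- 1 - s) * indicator {\<rho>..} \<theta>))"
    and "(\<integral>\<theta>. indicator {0<..} \<theta> * (\<theta> powr (- 1 - s) * indicator {\<rho>..} \<theta>) \<partial>lborel) = \<rho> powr (- s) / s"
proof -
  have eq: "indicator {0<..} \<theta> * (\<theta> powr (- 1 - s) * indicator {\<rho>..} \<theta>) = indicator {\<rho>..} \<theta> * \<theta> powr (- 1 - s)" for \<theta> :: real
    using \<rho> by (auto simp: indicator_def)
  have I: "((\<lambda>\<theta>. \<theta> powr (- 1 - s)) has_integral \<rho> powr (- s) / s) {\<rho>..}"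
  proof -
    have "- (\<rho> powr (- 1 - s + 1)) / (- 1 - s + 1) = \<rho> powr (- s) / s" by simp
    then show ?thesis using has_integral_powr_to_inf [of "-1-s" \<rho>] s \<rho> by simp
  qed
  then have abs: "(\<lambda>\<theta>. \<theta> powr (- 1 - s)) absolutely_integrable_on {\<rho>..}"
    by (intro nonnegative_absolutely_integrable_1) (auto simp: integrable_on_def)
  then show "integrable lborel (\<lambda>\<theta>::real. indicator {0<..} \<theta> * (\<theta> powr (- 1 - s) * indicator {\<rho>..} \<theta>))"
    unfolding eq set_integrable_def by (simp add: integrable_completion)
  have "(LINT \<theta>:{\<rho>..}|lebesgue. \<theta> powr (- 1 - s)) = \<rho> powr (- s) / s"
    using set_lebesgue_integral_eq_integral(2) [OF abs] integral_unique [OF I] by simp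
  then show "(\<integral>\<theta>. indicator {0<..} \<theta> * (\<theta> powr (- 1 - s) * indicator {\<rho>..} \<theta>) \<partial>lborel) = \<rho> powr (- s) / s"
    unfolding eq set_lebesgue_integral_def by (simp add: integral_completion)
qed

lemma set_integral_past:
  fixes f :: "real \<Rightarrow> real"
  assumes [measurable]: "f \<in> borel_measurable borel" and "integrable lborel (\<lambda>\<theta>. indicator {0<..} \<theta> * f \<theta>)"
  shows "set_integrable lebesgue {..<t} (\<lambda>\<tau>. f (t - \<tau>))"
    and "(LINT \<tau>:{..<t}|lebesgue. f (t - \<tau>)) = (\<integral>\<theta>. indicator {0<..} \<theta> * f \<theta> \<partial>lborel)"
proof -
  have ind: "indicator {0<..} (t + - 1 * \<tau>) = (indicator {..<t} \<tau> :: real)" for \<tau> by (simp add: indicator_def)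
  have "integrable lborel (\<lambda>\<tau>. indicator {0<..} (t + - 1 * \<tau>) * f (t + - 1 * \<tau>))"
    using assms(2) by (rule lborel_integrable_real_affine) simp
  then show "set_integrable lebesgue {..<t} (\<lambda>\<tau>. f (t - \<tau>))"
    unfolding set_integrable_def ind by (simp add: integrable_completion)
  show "(LINT \<tau>:{..<t}|lebesgue. f (t - \<tau>)) = (\<integral>\<theta>. indicator {0<..} \<theta> * f \<theta> \<partial>lborel)"
    using lborel_integral_real_affine [of "-1" "\<lambda>\<theta>. indicator {0<..} \<theta> * f \<theta>" t]
    unfolding set_lebesgue_integral_def ind by (simp add: integral_completion)
qed

text \<open>All later estimates have this form: a gain \<open>a\<close> at elapsed times beyond
  \<rho>, minus the price of a penalty of height \<open>A\<close> at all times. The explicit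
  minorant is integrated and compared with \<open>J\<close> directly, so \<open>D\<close> enters
  only through pointwise bounds.\<close>

lemma fractional_integral_lower:
  assumes s: "0 < s" "s < 1" and C: "0 \<le> C" and \<rho>: "0 < \<rho>"
    and J: "set_integrable lebesgue {..<t} J"
    and JD: "AE \<tau> in lebesgue. \<tau> < t \<longrightarrow> J \<tau> = (t - \<tau>) powr (- 1 - s) * D (t - \<tau>)"
    and D: "\<And>\<theta>. 0 < \<theta> \<Longrightarrow> a * indicator {\<rho>..} \<theta> - A * min 1 (C * \<theta>) \<le> D \<theta>"
  shows "a * (\<rho> powr (- s) / s) - A * frac_const s C \<le> (LINT \<tau>:{..<t}|lebesgue. J \<tau>)"
proof -
  define f where "f \<theta> = \<theta> powr (- 1 - s) * (a * indicator {\<rho>..} \<theta> - A * min 1 (C * \<theta>))" for \<theta> :: real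
  have f [measurable]: "f \<in> borel_measurable borel" unfolding f_def by measurable
  have eq: "indicator {0<..} \<theta> * f \<theta> = a * (indicator {0<..} \<theta> * (\<theta> powr (- 1 - s) * indicator {\<rho>..} \<theta>))
      - A * (indicator {0<..} \<theta> * (\<theta> powr (- 1 - s) * min 1 (C * \<theta>)))" for \<theta>
    by (simp add: f_def algebra_simps)
  note int = integral_tail_powr [OF s(1) \<rho>] integrable_frac_const [OF s C]
  have intf: "integrable lborel (\<lambda>\<theta>. indicator {0<..} \<theta> * f \<theta>)"
    unfolding eq using int by (intro Bochner_Integration.integrable_diff integrable_mult_right)
  have "a * (\<rho> powr (- s) / s) - A * frac_const s C = (\<integral>\<theta>. indicator {0<..} \<theta> * f \<theta> \<partial>lborel)"
    unfolding eq using int by (simp add: frac_const_def)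
  also have "\<dots> = (LINT \<tau>:{..<t}|lebesgue. f (t - \<tau>))"
    by (rule set_integral_past(2) [OF f intf, symmetric])
  also have "\<dots> \<le> (LINT \<tau>:{..<t}|lebesgue. J \<tau>)"
    unfolding set_lebesgue_integral_def
  proof (rule integral_mono_AE)
    show "integrable lebesgue (\<lambda>\<tau>. indicat_real {..<t} \<tau> *\<^sub>R f (t - \<tau>))"
      using set_integral_past(1) [OF f intf] by (simp add: set_integrable_def)
    show "integrable lebesgue (\<lambda>\<tau>. indicat_real {..<t} \<tau> *\<^sub>R J \<tau>)"
      using J by (simp add: set_integrable_def)
    show "AE \<tau> in lebesgue. indicat_real {..<t} \<tau> *\<^sub>R f (t - \<tau>) \<le> indicat_real {..<t} \<tau> *\<^sub>R J \<tau>"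
      using JD
    proof eventually_elim
      case (elim \<tau>)
      show ?case
      proof (cases "\<tau> < t")
        case True
        then have "f (t - \<tau>) \<le> J \<tau>"
          using elim D [of "t - \<tau>"] by (simp add: f_def mult_left_mono)
        then show ?thesis by (simp add: mult_left_mono)
      qed simp
    qed
  qed
  finally show ?thesis .
qed

section \<open>Penalised maxima over the past\<close>

text \<open>A capped paraboloid opening into the past, the only times the operator sees. Being 1
  away from a compact neighbourhood of the centre, it confines maxima; the cap bounds its cost at
  large elapsed times.\<close>

definition penalty :: "'a::euclidean_space \<Rightarrow> real \<Rightarrow> 'a \<Rightarrow> real \<Rightarrow> real" where
  "penalty x0 t0 y \<tau> = min 1 ((norm (y - x0))\<^sup>2 + (t0 - \<tau>))"

lemma penalty_le_1: "penalty x0 t0 y \<tau> \<le> 1"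
  by (simp add: penalty_def)

lemma penalty_nonneg: "\<tau> \<le> t0 \<Longrightarrow> 0 \<le> penalty x0 t0 y \<tau>"
  by (simp add: penalty_def)

lemma penalty_center [simp]: "penalty x0 t0 x0 t0 = 0"
  by (simp add: penalty_def)

lemma measurable_penalty [measurable]: "(\<lambda>y. penalty x0 t0 y \<tau>) \<in> borel_measurable borel"
  unfolding penalty_def by measurable

text \<open>Expand |a + sqrt \<theta> Z|^2: the linear term averages to 0, the quadratic one gives
  \<theta> times the second moment, and the shift back in time adds another \<theta>. Hypothesis
  \<open>Q\<close> says that the cap is inactive at (y, t), so that the paraboloid there equals the
  penalty. The alternative bound 1 is the cap.\<close>

lemma heat_avg_penalty:
  fixes y x0 :: "'a::euclidean_space"
  assumes t: "t \<le> t0" and Q: "(norm (y - x0))\<^sup>2 + (t0 - t) \<le> 1" and \<theta>: "0 < \<theta>"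
  shows "heat_avg (penalty x0 t0) y t \<theta>
    \<le> penalty x0 t0 y t + min 1 ((1 + heat_second_moment TYPE('a)) * \<theta>)"
proof -
  let ?r = "sqrt \<theta>"
  define a where "a = y - x0"
  have bd: "\<bar>penalty x0 t0 (y + ?r *\<^sub>R z) (t - \<theta>)\<bar> \<le> 1" for z
    using penalty_le_1 [of x0 t0 "y + ?r *\<^sub>R z" "t - \<theta>"] penalty_nonneg [of "t - \<theta>" t0 x0 "y + ?r *\<^sub>R z"] t \<theta>
    by simp
  have int: "integrable heat_prob (\<lambda>z. penalty x0 t0 (y + ?r *\<^sub>R z) (t - \<theta>))"
    by (rule integrable_heat_prob_bounded [OF _ bd]) simp
  have p: "penalty x0 t0 y t = (norm a)\<^sup>2 + (t0 - t)" using Q by (simp add: penalty_def a_def)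
  have p0: "0 \<le> penalty x0 t0 y t" using t by (rule penalty_nonneg)
  have "heat_avg (penalty x0 t0) y t \<theta> \<le> (\<integral>(z::'a). 1 \<partial>heat_prob)"
    unfolding heat_avg_def using int by (intro integral_mono) (simp_all add: penalty_le_1)
  then have 1: "heat_avg (penalty x0 t0) y t \<theta> \<le> penalty x0 t0 y t + 1"
    using p0 by (simp add: heat_prob.prob_space [simplified])
  have "heat_avg (penalty x0 t0) y t \<theta>
    \<le> (\<integral>z. (norm a)\<^sup>2 + (t0 - t) + \<theta> + (2 * ?r) * (a \<bullet> z) + \<theta> * (norm z)\<^sup>2 \<partial>heat_prob)"
    unfolding heat_avg_def
  proof (intro integral_mono int)
    show "integrable heat_prob (\<lambda>z. (norm a)\<^sup>2 + (t0 - t) + \<theta> + (2 * ?r) * (a \<bullet> z) + \<theta> * (norm z)\<^sup>2)"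
      using integrable_inner_heat [of a] integrable_norm_sq [where 'a = 'a] by simp
    fix z :: 'a
    have "y + ?r *\<^sub>R z - x0 = a + ?r *\<^sub>R z" by (simp add: a_def)
    then have "(norm (y + ?r *\<^sub>R z - x0))\<^sup>2 = (norm a)\<^sup>2 + 2 * (a \<bullet> (?r *\<^sub>R z)) + (norm (?r *\<^sub>R z))\<^sup>2"
      by (simp only: power2_norm_eq_inner inner_add_left inner_add_right) (simp add: inner_commute)
    also have "(norm (?r *\<^sub>R z))\<^sup>2 = \<theta> * (norm z)\<^sup>2" using \<theta> by (simp add: power_mult_distrib)
    finally show "penalty x0 t0 (y + ?r *\<^sub>R z) (t - \<theta>)
      \<le> (norm a)\<^sup>2 + (t0 - t) + \<theta> + (2 * ?r) * (a \<bullet> z) + \<theta> * (norm z)\<^sup>2"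
      unfolding penalty_def by simp
  qed
  also have "\<dots> = penalty x0 t0 y t + (1 + heat_second_moment TYPE('a)) * \<theta>"
    using integrable_inner_heat [of a] integrable_norm_sq [where 'a = 'a]
    by (simp add: heat_prob.prob_space [simplified] integral_inner_heat heat_second_moment_def p algebra_simps)
  finally show ?thesis using 1 by simp
qed

text \<open>f - A * penalty is maximised over the compact set \<open>K\<close> where the cap is
  inactive. Off \<open>K\<close> the penalty is 1, and f - A \<le> m - A \<le> f x0 t0, which is the
  penalised value at the centre; hence the maximum over \<open>K\<close> is one over the whole
  past.\<close>

lemma penalised_max:
  fixes f :: "'a::euclidean_space \<Rightarrow> real \<Rightarrow> real"
  assumes H: "closed H" "x0 \<in> H" and cont: "continuous_on UNIV (\<lambda>(y, \<tau>). f y \<tau>)"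
    and m: "\<And>y \<tau>. y \<in> H \<Longrightarrow> f y \<tau> \<le> m" and A: "m - A \<le> f x0 t0" "0 \<le> A"
  obtains y t where "y \<in> H" "t \<le> t0" "(norm (y - x0))\<^sup>2 + (t0 - t) \<le> 1" "f x0 t0 \<le> f y t"
    "\<And>y' \<tau>. y' \<in> H \<Longrightarrow> \<tau> \<le> t0 \<Longrightarrow> f y' \<tau> \<le> f y t + A * (penalty x0 t0 y' \<tau> - penalty x0 t0 y t)"
proof -
  define K where "K = (H \<times> {..t0}) \<inter> {p. (norm (fst p - x0))\<^sup>2 + (t0 - snd p) \<le> 1}"
  have "closed K"
    unfolding K_def by (intro closed_Int closed_Times H closed_atMost closed_Collect_le continuous_intros)
  moreover have "bounded K"
  proof (rule bounded_subset)
    show "bounded (cball x0 1 \<times> {t0 - 1..t0})" by (intro bounded_Times) auto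
    show "K \<subseteq> cball x0 1 \<times> {t0 - 1..t0}"
    proof
      fix p assume "p \<in> K"
      then have p: "snd p \<le> t0" "(norm (fst p - x0))\<^sup>2 + (t0 - snd p) \<le> 1" by (auto simp: K_def)
      then have "(norm (fst p - x0))\<^sup>2 \<le> 1\<^sup>2" "t0 - 1 \<le> snd p"
        using zero_le_power2 [of "norm (fst p - x0)"] by (simp, linarith)
      then have "norm (fst p - x0) \<le> 1" using power2_le_imp_le [of "norm (fst p - x0)" 1] by simp
      with p \<open>t0 - 1 \<le> snd p\<close> show "p \<in> cball x0 1 \<times> {t0 - 1..t0}"
        by (cases p) (simp add: dist_norm norm_minus_commute)
    qed
  qed
  ultimately have K: "compact K" by (simp add: compact_eq_bounded_closed)
  have x0: "(x0, t0) \<in> K" using H by (simp add: K_def)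
  define g where "g p = f (fst p) (snd p) - A * penalty x0 t0 (fst p) (snd p)" for p
  have "continuous_on K (\<lambda>p. f (fst p) (snd p))"
    using continuous_on_subset [OF cont subset_UNIV, of K] by (simp add: case_prod_unfold)
  then have "continuous_on K g"
    unfolding g_def penalty_def by (intro continuous_intros)
  then obtain p where p: "p \<in> K" "\<And>q. q \<in> K \<Longrightarrow> g q \<le> g p"
    using continuous_attains_sup [OF K, of g] x0 by blast
  obtain y t where yt: "p = (y, t)" by (cases p)
  have y: "y \<in> H" "t \<le> t0" "(norm (y - x0))\<^sup>2 + (t0 - t) \<le> 1"
    using p(1) by (auto simp: K_def yt)
  have g0: "f x0 t0 \<le> g p" using p(2) [OF x0] by (simp add: g_def)
  show thesis
  proof
    show "y \<in> H" "t \<le> t0" "(norm (y - x0))\<^sup>2 + (t0 - t) \<le> 1" by (fact y)+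
    show "f x0 t0 \<le> f y t"
    proof -
      have "0 \<le> A * penalty x0 t0 y t" by (intro mult_nonneg_nonneg A(2) penalty_nonneg y(2))
      then show ?thesis using g0 by (simp add: g_def yt)
    qed
    show "f y' \<tau> \<le> f y t + A * (penalty x0 t0 y' \<tau> - penalty x0 t0 y t)" if "y' \<in> H" "\<tau> \<le> t0" for y' \<tau>
    proof (cases "(norm (y' - x0))\<^sup>2 + (t0 - \<tau>) \<le> 1")
      case True
      then have "g (y', \<tau>) \<le> g p" using that by (intro p(2)) (simp add: K_def)
      then show ?thesis by (simp add: g_def yt algebra_simps)
    next
      case False
      then have "penalty x0 t0 y' \<tau> = 1" by (simp add: penalty_def)
      then show ?thesis using m [OF that(1), of \<tau>] A g0 by (simp add: g_def yt algebra_simps)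
    qed
  qed
qed

section \<open>Joint continuity of functions in the local parabolic classes\<close>

text \<open>For \<open>\<alpha> > 1\<close> the Hoelder conditions do not control the spatial gradient in time directly, so joint
  continuity is derived from a modulus in \<open>t\<close> and continuity in \<open>x\<close> for each fixed \<open>t\<close> only.\<close>

lemma continuous_of_time_modulus:
  fixes u :: "'a::metric_space \<Rightarrow> real \<Rightarrow> real"
  assumes x: "\<And>t. continuous_on UNIV (\<lambda>x. u x t)"
    and \<alpha>: "0 < \<alpha>"
    and t: "\<And>x0 t0. \<exists>C. \<forall>x t. dist x x0 \<le> 1 \<longrightarrow> \<bar>t - t0\<bar> \<le> 1 \<longrightarrow> \<bar>u x t - u x t0\<bar> \<le> C * \<bar>t - t0\<bar> powr \<alpha>"
  shows "continuous_on UNIV (\<lambda>(x, t). u x t)"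
proof -
  have "((\<lambda>p. u (fst p) (snd p)) \<longlongrightarrow> u x0 t0) (at (x0, t0))" for x0 t0
  proof -
    let ?F = "at (x0, t0) :: ('a \<times> real) filter"
    obtain C where C: "\<And>x t. dist x x0 \<le> 1 \<Longrightarrow> \<bar>t - t0\<bar> \<le> 1 \<Longrightarrow> \<bar>u x t - u x t0\<bar> \<le> C * \<bar>t - t0\<bar> powr \<alpha>"
      using t by blast
    have fs: "(fst \<longlongrightarrow> x0) ?F" "(snd \<longlongrightarrow> t0) ?F"
      using tendsto_fst [OF tendsto_ident_at, of "(x0, t0)" UNIV] tendsto_snd [OF tendsto_ident_at, of "(x0, t0)" UNIV]
      by simp_all
    have 1: "((\<lambda>p. u (fst p) t0) \<longlongrightarrow> u x0 t0) ?F"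
      using continuous_on_tendsto_compose [OF x fs(1)] by simp
    have ab: "((\<lambda>p. \<bar>snd p - t0\<bar>) \<longlongrightarrow> 0) ?F" using fs(2) by (intro tendsto_eq_intros) auto
    have "((\<lambda>p. C * \<bar>snd p - t0\<bar> powr \<alpha>) \<longlongrightarrow> C * 0 powr \<alpha>) ?F"
      by (intro tendsto_mult tendsto_const tendsto_powr' ab) (use \<alpha> in auto)
    then have 2: "((\<lambda>p. C * \<bar>snd p - t0\<bar> powr \<alpha>) \<longlongrightarrow> 0) ?F" using \<alpha> by simp
    have "eventually (\<lambda>p. dist (fst p) x0 < 1) ?F" "eventually (\<lambda>p. \<bar>snd p - t0\<bar> < 1) ?F"
      using tendstoD [OF fs(1), of 1] order_tendstoD(2) [OF ab, of 1] by simp_all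
    then have "eventually (\<lambda>p. norm (u (fst p) (snd p) - u (fst p) t0) \<le> C * \<bar>snd p - t0\<bar> powr \<alpha>) ?F"
      by eventually_elim (use C in auto)
    then have "((\<lambda>p. u (fst p) (snd p) - u (fst p) t0) \<longlongrightarrow> 0) ?F"
      using 2 by (rule Lim_null_comparison)
    from tendsto_add [OF this 1] show ?thesis by simp
  qed
  then show ?thesis
    by (auto simp: continuous_on_def case_prod_unfold)
qed

text \<open>The induction is used for \<alpha> > 1: the time derivative is continuous by the
  induction hypothesis, hence bounded on compact sets, and the mean value theorem makes
  \<open>u\<close> locally Lipschitz in time. For smaller \<alpha> the time modulus is part of the
  Hoelder condition.\<close>

lemma parabolic_holder_loc_continuous:
  "parabolic_holder_loc \<alpha> u \<Longrightarrow> continuous_on UNIV (\<lambda>(x, t). u x t)"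
proof (induction rule: parabolic_holder_loc.induct)
  case (low \<alpha> u)
  show ?case
  proof (rule continuous_of_time_modulus [OF _ low(1)])
    show "continuous_on UNIV (\<lambda>x. u x t1)" for t1
    proof -
      have "((\<lambda>x. u x t1) \<longlongrightarrow> u x0 t1) (at x0)" for x0
      proof -
        obtain C where C: "\<forall>(x, t)\<in>cball x0 1 \<times> {t1 - 1..t1 + 1}. \<forall>(y, \<tau>)\<in>cball x0 1 \<times> {t1 - 1..t1 + 1}.
           \<bar>u x t - u y \<tau>\<bar> \<le> C * (norm (x - y) + \<bar>t - \<tau>\<bar> powr (1/2)) powr (2 * \<alpha>)"
          using low(3) [of "cball x0 1 \<times> {t1 - 1..t1 + 1}"] by (force intro: bounded_Times)
        have n: "((\<lambda>x. norm (x - x0)) \<longlongrightarrow> 0) (at x0)"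
          by (intro tendsto_eq_intros) auto
        have "((\<lambda>x. C * norm (x - x0) powr (2 * \<alpha>)) \<longlongrightarrow> C * 0 powr (2 * \<alpha>)) (at x0)"
          by (intro tendsto_mult tendsto_const tendsto_powr' n) (use low(1) in auto)
        then have 2: "((\<lambda>x. C * norm (x - x0) powr (2 * \<alpha>)) \<longlongrightarrow> 0) (at x0)" using low(1) by simp
        have "eventually (\<lambda>x. norm (x - x0) < 1) (at x0)"
          using order_tendstoD(2) [OF n, of 1] by simp
        then have "eventually (\<lambda>x. norm (u x t1 - u x0 t1) \<le> C * norm (x - x0) powr (2 * \<alpha>)) (at x0)"
        proof eventually_elim
          case (elim x)
          then have "(x, t1) \<in> cball x0 1 \<times> {t1 - 1..t1 + 1}" "(x0, t1) \<in> cball x0 1 \<times> {t1 - 1..t1 + 1}"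
            by (auto simp: dist_norm norm_minus_commute)
          with C have "\<bar>u x t1 - u x0 t1\<bar> \<le> C * (norm (x - x0) + \<bar>t1 - t1\<bar> powr (1/2)) powr (2 * \<alpha>)" by blast
          then show ?case by simp
        qed
        then have "((\<lambda>x. u x t1 - u x0 t1) \<longlongrightarrow> 0) (at x0)" using 2 by (rule Lim_null_comparison)
        then show ?thesis using LIM_zero_iff by blast
      qed
      then show ?thesis by (simp add: continuous_on_def)
    qed
    show "\<exists>C. \<forall>x t. dist x x0 \<le> 1 \<longrightarrow> \<bar>t - t0\<bar> \<le> 1 \<longrightarrow> \<bar>u x t - u x t0\<bar> \<le> C * \<bar>t - t0\<bar> powr \<alpha>" for x0 t0
    proof -
      obtain C where C: "\<forall>(x, t)\<in>cball x0 1 \<times> {t0 - 1..t0 + 1}. \<forall>(y, \<tau>)\<in>cball x0 1 \<times> {t0 - 1..t0 + 1}.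
         \<bar>u x t - u y \<tau>\<bar> \<le> C * (norm (x - y) + \<bar>t - \<tau>\<bar> powr (1/2)) powr (2 * \<alpha>)"
        using low(3) [of "cball x0 1 \<times> {t0 - 1..t0 + 1}"] by (force intro: bounded_Times)
      have "\<bar>u x t - u x t0\<bar> \<le> C * \<bar>t - t0\<bar> powr \<alpha>" if "dist x x0 \<le> 1" "\<bar>t - t0\<bar> \<le> 1" for x t
      proof -
        have "(x, t) \<in> cball x0 1 \<times> {t0 - 1..t0 + 1}" "(x, t0) \<in> cball x0 1 \<times> {t0 - 1..t0 + 1}"
          using that by (auto simp: dist_commute abs_le_iff)
        with C have "\<bar>u x t - u x t0\<bar> \<le> C * (norm (x - x) + \<bar>t - t0\<bar> powr (1/2)) powr (2 * \<alpha>)" by blast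
        then show ?thesis by (simp add: powr_powr)
      qed
      then show ?thesis by blast
    qed
  qed
next
  case (mid \<alpha> u G)
  show ?case
  proof (rule continuous_of_time_modulus)
    show "0 < \<alpha>" using mid(1) by simp
    show "continuous_on UNIV (\<lambda>x. u x t)" for t
      using mid(4) by (intro continuous_at_imp_continuous_on ballI has_derivative_continuous) (auto simp: gderiv_def)
    show "\<exists>C. \<forall>x t. dist x x0 \<le> 1 \<longrightarrow> \<bar>t - t0\<bar> \<le> 1 \<longrightarrow> \<bar>u x t - u x t0\<bar> \<le> C * \<bar>t - t0\<bar> powr \<alpha>" for x0 t0
    proof -
      have "bounded (cball x0 (1::real) \<times> {t0 - 1..t0 + 1 :: real})"
        by (intro bounded_Times) auto
      from mid(3) [OF this] obtain C where C: "\<And>x t \<tau>. (x, t) \<in> cball x0 1 \<times> {t0 - 1..t0 + 1} \<Longrightarrow>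
          (x, \<tau>) \<in> cball x0 1 \<times> {t0 - 1..t0 + 1} \<Longrightarrow> \<bar>u x t - u x \<tau>\<bar> \<le> C * \<bar>t - \<tau>\<bar> powr \<alpha>"
        by blast
      show ?thesis by (intro exI [of _ C] allI impI C) (auto simp: dist_commute abs_le_iff)
    qed
  qed
next
  case (high \<alpha> u v G H)
  show ?case
  proof (rule continuous_of_time_modulus [where \<alpha> = 1])
    show "continuous_on UNIV (\<lambda>x. u x t)" for t
      using high(3) by (intro continuous_at_imp_continuous_on ballI has_derivative_continuous) (auto simp: gderiv_def)
    show "\<exists>C. \<forall>x t. dist x x0 \<le> 1 \<longrightarrow> \<bar>t - t0\<bar> \<le> 1 \<longrightarrow> \<bar>u x t - u x t0\<bar> \<le> C * \<bar>t - t0\<bar> powr 1" for x0 t0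
    proof -
      let ?K = "cball x0 (1::real) \<times> {t0 - 1..t0 + 1 :: real}"
      have "compact ?K" by (intro compact_Times) auto
      then have "bounded ((\<lambda>(x, t). v x t) ` ?K)"
        using high.IH(1) by (intro compact_imp_bounded compact_continuous_image) (auto intro: continuous_on_subset)
      then obtain C where C: "\<And>x t. (x, t) \<in> ?K \<Longrightarrow> \<bar>v x t\<bar> \<le> C"
        unfolding bounded_iff by fastforce
      have "\<bar>u x t - u x t0\<bar> \<le> C * \<bar>t - t0\<bar>" if x: "dist x x0 \<le> 1" and t: "\<bar>t - t0\<bar> \<le> 1" for x t
      proof -
        have "norm (u x t - u x t0) \<le> C * norm (t - t0)"
        proof (rule field_differentiable_bound [where f' = "v x" and S = "{t0 - 1..t0 + 1}"])
          show "convex {t0 - 1..t0 + 1}" by simp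
          show "(u x has_field_derivative v x z) (at z within {t0 - 1..t0 + 1})" for z
            using high(2) [of x z] by (rule has_field_derivative_at_within)
          show "norm (v x z) \<le> C" if "z \<in> {t0 - 1..t0 + 1}" for z
            using C [of x z] that x by (simp add: dist_commute)
        qed (use t in \<open>auto simp: abs_le_iff\<close>)
        then show ?thesis by simp
      qed
      then show ?thesis by (intro exI [of _ C]) simp
    qed
  qed simp
qed

section \<open>Elementary inequalities for real powers\<close>

lemma ex_powr_neg_large:
  assumes "0 < (s::real)"
  obtains \<rho> where "0 < \<rho>" "X < \<rho> powr (- s)"
proof
  show "0 < (\<bar>X\<bar> + 1) powr (- 1 / s)" by simp
  have "((\<bar>X\<bar> + 1) powr (- 1 / s)) powr (- s) = \<bar>X\<bar> + 1"
    using assms by (simp add: powr_powr)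
  then show "X < ((\<bar>X\<bar> + 1) powr (- 1 / s)) powr (- s)" by simp
qed

lemma powr_diff_le:
  assumes "0 < b" "b \<le> a" "1 < (p::real)"
  shows "a powr p - b powr p \<le> p * a powr (p - 1) * (a - b)"
proof (cases "a = b")
  case False
  then have "b < a" using assms by simp
  have "\<exists>z. b < z \<and> z < a \<and> a powr p - b powr p = (a - b) * (p * z powr (p - 1))"
    using \<open>b < a\<close> assms by (intro MVT2) (auto intro!: derivative_eq_intros)
  then obtain z where z: "b < z" "z < a" "a powr p - b powr p = (a - b) * (p * z powr (p - 1))" by blast
  have "z powr (p - 1) \<le> a powr (p - 1)" using z assms by (intro powr_mono2) auto
  then have "(a - b) * (p * z powr (p - 1)) \<le> (a - b) * (p * a powr (p - 1))"
    using assms by (intro mult_left_mono) auto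
  then show ?thesis using z(3) by (simp add: mult_ac)
qed simp

text \<open>Superadditivity of the p-th power, from monotonicity of x^(p-1). Unlike a mean value
  bound with b^(p-1), it does not degenerate as \<open>b\<close> tends to 0.\<close>

lemma powr_diff_ge:
  assumes "0 < b" "b \<le> a" "1 < (p::real)"
  shows "(a - b) powr p \<le> a powr p - b powr p"
proof -
  have split: "x powr p = x powr (p - 1) * x" if "0 \<le> x" for x
    using that powr_add [of x "p - 1" 1] by (cases "x = 0") simp_all
  have "(a - b) powr (p - 1) * (a - b) \<le> a powr (p - 1) * (a - b)"
    using assms by (intro mult_right_mono powr_mono2) auto
  moreover have "b powr (p - 1) * b \<le> a powr (p - 1) * b"
    using assms by (intro mult_right_mono powr_mono2) auto
  moreover have "a powr p = a powr (p - 1) * (a - b) + a powr (p - 1) * b"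
    using assms split [of a] by (simp add: algebra_simps)
  ultimately show ?thesis
    using assms split [of b] split [of "a - b"] by linarith
qed

section \<open>The solution and its equation compared at one or two points\<close>

locale positive_master_solution =
  fixes s p M :: real and e :: "real ^ 'n" and u :: "real ^ 'n \<Rightarrow> real \<Rightarrow> real"
  assumes s: "0 < s" "s < 1" and p: "1 < p" and e: "e \<in> Basis"
    and pos: "\<And>x t. 0 < u x t" and bounded: "\<And>x t. u x t \<le> M"
    and cont: "continuous_on UNIV (\<lambda>(x, t). u x t)"
    and equation: "\<And>x t. has_master_value s u x t ((x \<bullet> e) * u x t powr p)"
begin

definition rate :: real where "rate = master_rate TYPE('n) s"
text \<open>Growth rate of the averaged paraboloid: 1 from its slope in time, the second moment from
  its curvature in space.\<close>

definition pen_rate :: real where "pen_rate = 1 + heat_second_moment TYPE(real ^ 'n)"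
definition pen_cost :: real where "pen_cost = frac_const s pen_rate"
definition tail :: real where "tail = measure heat_prob {z :: real ^ 'n. z \<bullet> e > 1}"

lemma constants:
  "0 < rate" "0 < pen_rate" "0 \<le> pen_cost" "0 < tail"
  using master_rate_pos [OF s] heat_second_moment_nonneg [where 'a = "real ^ 'n"]
    heat_tail_pos [OF e]
  by (auto simp: rate_def pen_rate_def pen_cost_def tail_def intro!: frac_const_nonneg)

lemma M_pos: "0 < M"
  using pos bounded less_le_trans by blast

lemma slice_continuous: "continuous_on UNIV (\<lambda>x. u x t)"
proof -
  have "continuous_on UNIV (\<lambda>x. (\<lambda>(x, t). u x t) (x, t))"
    by (intro continuous_on_compose2 [OF cont] continuous_intros) auto
  then show ?thesis by simp
qed

lemma slice_measurable [measurable]: "(\<lambda>x. u x t) \<in> borel_measurable borel"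
  by (intro borel_measurable_continuous_onI slice_continuous)

lemma abs_le_M: "\<bar>u x t\<bar> \<le> M"
  using pos [of x t] bounded [of x t] by simp

lemma equationE:
  obtains J where "set_integrable lebesgue {..<t} J"
    and "AE \<tau> in lebesgue. \<tau> < t \<longrightarrow> J \<tau> = (t - \<tau>) powr (- 1 - s) * (u x t - heat_avg u x t (t - \<tau>))"
    and "(x \<bullet> e) * u x t powr p = rate * (LINT \<tau>:{..<t}|lebesgue. J \<tau>)"
  using has_master_valueE [OF equation slice_measurable abs_le_M, of t x] unfolding rate_def by blast

text \<open>The densities are subtracted before anything is estimated, since the penalised maximum
  controls only the difference of the two integrands.\<close>

lemma difference_lower:
  assumes \<rho>: "0 < \<rho>"
    and D: "\<And>\<theta>. 0 < \<theta> \<Longrightarrow> a * indicator {\<rho>..} \<theta> - A * min 1 (pen_rate * \<theta>)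
      \<le> (u x t - heat_avg u x t \<theta>) - (u x' t - heat_avg u x' t \<theta>)"
  shows "rate * (a * (\<rho> powr (- s) / s) - A * pen_cost)
    \<le> (x \<bullet> e) * u x t powr p - (x' \<bullet> e) * u x' t powr p"
proof -
  obtain J where J: "set_integrable lebesgue {..<t} J"
    "AE \<tau> in lebesgue. \<tau> < t \<longrightarrow> J \<tau> = (t - \<tau>) powr (- 1 - s) * (u x t - heat_avg u x t (t - \<tau>))"
    "(x \<bullet> e) * u x t powr p = rate * (LINT \<tau>:{..<t}|lebesgue. J \<tau>)"
    by (rule equationE)
  obtain J' where J': "set_integrable lebesgue {..<t} J'"
    "AE \<tau> in lebesgue. \<tau> < t \<longrightarrow> J' \<tau> = (t - \<tau>) powr (- 1 - s) * (u x' t - heat_avg u x' t (t - \<tau>))"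
    "(x' \<bullet> e) * u x' t powr p = rate * (LINT \<tau>:{..<t}|lebesgue. J' \<tau>)"
    by (rule equationE)
  have "a * (\<rho> powr (- s) / s) - A * frac_const s pen_rate \<le> (LINT \<tau>:{..<t}|lebesgue. J \<tau> - J' \<tau>)"
  proof (rule fractional_integral_lower [OF s less_imp_le [OF constants(2)] \<rho> _ _ D])
    show "set_integrable lebesgue {..<t} (\<lambda>\<tau>. J \<tau> - J' \<tau>)"
      by (intro set_integral_diff J J')
    show "AE \<tau> in lebesgue. \<tau> < t \<longrightarrow> J \<tau> - J' \<tau> = (t - \<tau>) powr (- 1 - s) *
      ((u x t - heat_avg u x t (t - \<tau>)) - (u x' t - heat_avg u x' t (t - \<tau>)))"
      using J(2) J'(2) by eventually_elim (simp add: right_diff_distrib)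
  qed
  also have "\<dots> = (LINT \<tau>:{..<t}|lebesgue. J \<tau>) - (LINT \<tau>:{..<t}|lebesgue. J' \<tau>)"
    by (intro set_integral_diff J J')
  finally have "rate * (a * (\<rho> powr (- s) / s) - A * pen_cost)
    \<le> rate * ((LINT \<tau>:{..<t}|lebesgue. J \<tau>) - (LINT \<tau>:{..<t}|lebesgue. J' \<tau>))"
    using constants(1) by (intro mult_left_mono) (auto simp: pen_cost_def)
  then show ?thesis by (simp add: J(3) J'(3) right_diff_distrib)
qed

text \<open>The lower bound applied to \<open>- J\<close> with gain 0: at a penalised minimum of
  \<open>u\<close> the operator is at most the cost of the penalty.\<close>

lemma value_upper:
  assumes D: "\<And>\<theta>. 0 < \<theta> \<Longrightarrow> u x t - heat_avg u x t \<theta> \<le> A * min 1 (pen_rate * \<theta>)"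
  shows "(x \<bullet> e) * u x t powr p \<le> rate * (A * pen_cost)"
proof -
  obtain J where J: "set_integrable lebesgue {..<t} J"
    "AE \<tau> in lebesgue. \<tau> < t \<longrightarrow> J \<tau> = (t - \<tau>) powr (- 1 - s) * (u x t - heat_avg u x t (t - \<tau>))"
    "(x \<bullet> e) * u x t powr p = rate * (LINT \<tau>:{..<t}|lebesgue. J \<tau>)"
    by (rule equationE)
  have "0 * (1 powr (- s) / s) - A * frac_const s pen_rate \<le> (LINT \<tau>:{..<t}|lebesgue. - J \<tau>)"
  proof (rule fractional_integral_lower [OF s less_imp_le [OF constants(2)] zero_less_one])
    show "set_integrable lebesgue {..<t} (\<lambda>\<tau>. - J \<tau>)"
      using J(1) by (simp add: set_integrable_def)
    show "AE \<tau> in lebesgue. \<tau> < t \<longrightarrow> - J \<tau> = (t - \<tau>) powr (- 1 - s) * (- (u x t - heat_avg u x t (t - \<tau>)))"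
      using J(2) by eventually_elim (simp add: algebra_simps)
    show "0 * indicat_real {1..} \<theta> - A * min 1 (pen_rate * \<theta>) \<le> - (u x t - heat_avg u x t \<theta>)" if "0 < \<theta>" for \<theta>
      using D [OF that] by simp
  qed
  then have "(LINT \<tau>:{..<t}|lebesgue. J \<tau>) \<le> A * pen_cost"
    by (simp add: set_lebesgue_integral_def pen_cost_def)
  then show ?thesis using constants(1) by (simp add: J(3))
qed

lemma heat_avg_penalty':
  fixes y x0 :: "real ^ 'n"
  assumes "t \<le> t0" "(norm (y - x0))\<^sup>2 + (t0 - t) \<le> 1" "0 < \<theta>"
  shows "heat_avg (penalty x0 t0) y t \<theta> \<le> penalty x0 t0 y t + min 1 (pen_rate * \<theta>)"
  using heat_avg_penalty [OF assms] by (simp add: pen_rate_def)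

lemma integrable_u [simp]: "integrable heat_prob (\<lambda>z :: real ^ 'n. u (x + r *\<^sub>R z) t)"
  by (rule integrable_heat_prob_bounded [of _ M]) (auto simp: abs_le_M)

lemma integrable_penalty:
  assumes "\<tau> \<le> t0" shows "integrable heat_prob (\<lambda>z :: real ^ 'n. penalty x0 t0 (x + r *\<^sub>R z) \<tau>)"
  using penalty_nonneg [OF assms, of x0] penalty_le_1 [of x0 t0]
  by (intro integrable_heat_prob_bounded [of _ 1]) (auto simp: abs_of_nonneg)

text \<open>Stated for an arbitrary \<open>g\<close> because it is applied to a difference of
  translates, to a barrier and to \<open>- u\<close>.\<close>

lemma heat_avg_le_of_penalised_max:
  fixes y x0 :: "real ^ 'n"
  assumes t: "t \<le> t0" "(norm (y - x0))\<^sup>2 + (t0 - t) \<le> 1" and \<theta>: "0 < \<theta>" and A: "0 \<le> A"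
    and g: "integrable heat_prob g"
    and le: "\<And>z. g z \<le> c + A * (penalty x0 t0 (y + sqrt \<theta> *\<^sub>R z) (t - \<theta>) - penalty x0 t0 y t)"
  shows "(\<integral>z. g z \<partial>heat_prob) \<le> c + A * min 1 (pen_rate * \<theta>)"
proof -
  have int: "integrable heat_prob (\<lambda>z. penalty x0 t0 (y + sqrt \<theta> *\<^sub>R z) (t - \<theta>))"
    by (rule integrable_penalty) (use t \<theta> in simp)
  have "(\<integral>z. g z \<partial>heat_prob)
    \<le> (\<integral>z. c + A * (penalty x0 t0 (y + sqrt \<theta> *\<^sub>R z) (t - \<theta>) - penalty x0 t0 y t) \<partial>heat_prob)"
    using int by (intro integral_mono g le) simp
  also have "\<dots> = c + A * (heat_avg (penalty x0 t0) y t \<theta> - penalty x0 t0 y t)"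
    using int by (simp add: heat_avg_def heat_prob.prob_space [simplified])
  also have "\<dots> \<le> c + A * min 1 (pen_rate * \<theta>)"
    using heat_avg_penalty' [OF t \<theta>] A by (intro add_left_mono mult_left_mono) auto
  finally show ?thesis .
qed

section \<open>A uniform one-sided modulus of continuity\<close>

text \<open>Moving the centre by h moves the Gaussian variable by h / sqrt \<theta>, so the estimate
  improves with elapsed time.\<close>

lemma heat_avg_shift_le:
  assumes \<theta>: "0 < \<theta>" and h: "0 \<le> h"
  shows "heat_avg u x t \<theta> - heat_avg u (x + h *\<^sub>R e) t \<theta> \<le> M * ((h / sqrt \<theta>) * pen_rate + (h / sqrt \<theta>)\<^sup>2)"
proof -
  let ?f = "\<lambda>z. u (x + sqrt \<theta> *\<^sub>R z) (t - \<theta>)" and ?a = "(h / sqrt \<theta>) *\<^sub>R e"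
  have a: "norm ?a = h / sqrt \<theta>" using e \<theta> h by simp
  have sh: "?f (z + ?a) = u (x + h *\<^sub>R e + sqrt \<theta> *\<^sub>R z) (t - \<theta>)" for z
    using \<theta> by (simp add: scaleR_add_right algebra_simps)
  have "heat_avg u x t \<theta> - heat_avg u (x + h *\<^sub>R e) t \<theta> = (\<integral>z. ?f z - ?f (z + ?a) \<partial>heat_prob)"
    unfolding heat_avg_def sh by simp
  also have "\<dots> \<le> M * (norm ?a * pen_rate + (norm ?a)\<^sup>2)"
    unfolding pen_rate_def by (rule heat_shift) (auto simp: bounded intro: less_imp_le [OF pos])
  finally show ?thesis unfolding a .
qed

text \<open>Suppose the drop exceeds \<eta> at x0. At a penalised maximum nearby it still does,
  while for \<theta> \<ge> \<rho> its average is at most \<eta>/2 by smoothing. The surplus \<eta>/2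
  integrates to a multiple of \<rho>^(-s), too much for the equation. The range up to
  \<open>2 * \<Lambda>\<close> accommodates mirror images of points with positive first coordinate
  in planes l \<le> \<Lambda>.\<close>

lemma uniform_modulus:
  assumes \<Lambda>: "0 \<le> \<Lambda>" and \<eta>: "0 < \<eta>"
  obtains h0 where "0 < h0" "\<And>h y t. 0 < h \<Longrightarrow> h \<le> h0 \<Longrightarrow> 0 \<le> y \<bullet> e \<Longrightarrow> y \<bullet> e \<le> 2 * \<Lambda> \<Longrightarrow>
    u y t - u (y + h *\<^sub>R e) t \<le> \<eta>"
proof -
  \<comment> \<open>Chosen to give \<open>big\<close>: the gain must beat the penalty of height M
    and the right-hand side, which is at most (2 \<Lambda> + 1) M^p within distance 1 of x0.\<close>
  let ?X = "((2 * \<Lambda> + 1) * M powr p / rate + M * pen_cost) * (2 * s / \<eta>)"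
  obtain \<rho> where \<rho>: "0 < \<rho>" "?X < \<rho> powr (- s)" using ex_powr_neg_large [OF s(1)] by blast
  have big: "(2 * \<Lambda> + 1) * M powr p < rate * (\<eta> / 2 * (\<rho> powr (- s) / s) - M * pen_cost)"
  proof -
    have "(2 * \<Lambda> + 1) * M powr p / rate + M * pen_cost = ?X * (\<eta> / (2 * s))"
      using \<eta> s by simp
    also have "\<dots> < \<rho> powr (- s) * (\<eta> / (2 * s))"
      using \<rho>(2) \<eta> s by (intro mult_strict_right_mono) auto
    finally have "(2 * \<Lambda> + 1) * M powr p / rate < \<eta> / 2 * (\<rho> powr (- s) / s) - M * pen_cost"
      by (simp add: mult_ac)
    then show ?thesis using constants(1) by (simp add: pos_divide_less_eq mult.commute)
  qed
  \<comment> \<open>The admissible shift in Gaussian units; the cap 1 allows r^2 \<le> r, making the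
    bound linear in r.\<close>
  define r0 where "r0 = min 1 (\<eta> / (2 * M * (pen_rate + 1)))"
  have r0: "0 < r0" using \<eta> M_pos constants(2) by (simp add: r0_def)
  have r0_small: "M * (r * pen_rate + r\<^sup>2) \<le> \<eta> / 2" if "0 \<le> r" "r \<le> r0" for r
  proof -
    have "r \<le> 1" "r \<le> \<eta> / (2 * M * (pen_rate + 1))" using that by (simp_all add: r0_def)
    then have "r\<^sup>2 \<le> r" "r * (2 * M * (pen_rate + 1)) \<le> \<eta>"
      using that M_pos constants(2) by (simp_all add: power2_eq_square mult_left_le_one_le pos_le_divide_eq)
    then have "M * (r * pen_rate + r\<^sup>2) \<le> M * (r * pen_rate + r)"
      using M_pos by (intro mult_left_mono) auto
    also have "\<dots> = r * (2 * M * (pen_rate + 1)) / 2" by (simp add: algebra_simps)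
    finally show ?thesis using \<open>r * _ \<le> \<eta>\<close> by linarith
  qed
  show thesis
  proof
    show "0 < r0 * sqrt \<rho>" using r0 \<rho> by simp
    fix h x0 t0 assume h: "0 < h" "h \<le> r0 * sqrt \<rho>" and x0: "0 \<le> x0 \<bullet> e" "x0 \<bullet> e \<le> 2 * \<Lambda>"
    define f where "f y \<tau> = u y \<tau> - u (y + h *\<^sub>R e) \<tau>" for y \<tau>
    show "u x0 t0 - u (x0 + h *\<^sub>R e) t0 \<le> \<eta>"
    proof (rule ccontr)
      assume "\<not> ?thesis"
      then have f0: "\<eta> < f x0 t0" by (simp add: f_def)
      have "continuous_on UNIV (\<lambda>q. (\<lambda>(x, t). u x t) (fst q, snd q) - (\<lambda>(x, t). u x t) (fst q + h *\<^sub>R e, snd q))"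
        by (intro continuous_on_diff continuous_on_compose2 [OF cont] continuous_intros) auto
      then have fcont: "continuous_on UNIV (\<lambda>(y, \<tau>). f y \<tau>)" by (simp add: f_def case_prod_unfold)
      have fM: "f y \<tau> \<le> M" for y \<tau> using bounded [of y \<tau>] pos [of "y + h *\<^sub>R e" \<tau>] by (simp add: f_def)
      \<comment> \<open>Height M is admissible at any point with f > 0, since f \<le> M. The maximum
        stays within distance 1 of x0, which bounds its first coordinate.\<close>
      obtain y t where yt: "t \<le> t0" "(norm (y - x0))\<^sup>2 + (t0 - t) \<le> 1" "f x0 t0 \<le> f y t"
        "\<And>y' \<tau>. \<tau> \<le> t0 \<Longrightarrow> f y' \<tau> \<le> f y t + M * (penalty x0 t0 y' \<tau> - penalty x0 t0 y t)"
        by (rule penalised_max [of UNIV x0 f M M t0]) (use fcont fM f0 \<eta> M_pos in auto)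
      let ?y = "y + h *\<^sub>R e"
      have "rate * (\<eta> / 2 * (\<rho> powr (- s) / s) - M * pen_cost)
        \<le> (y \<bullet> e) * u y t powr p - (?y \<bullet> e) * u ?y t powr p"
      proof (rule difference_lower [OF \<rho>(1)])
        fix \<theta> :: real assume \<theta>: "0 < \<theta>"
        have D: "(u y t - heat_avg u y t \<theta>) - (u ?y t - heat_avg u ?y t \<theta>)
          = f y t - (heat_avg u y t \<theta> - heat_avg u ?y t \<theta>)" by (simp add: f_def)
        have avg: "heat_avg u y t \<theta> - heat_avg u ?y t \<theta> = (\<integral>z. f (y + sqrt \<theta> *\<^sub>R z) (t - \<theta>) \<partial>heat_prob)"
          using integrable_u [of ?y "sqrt \<theta>" "t - \<theta>"] by (simp add: heat_avg_def f_def add_ac)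
        have 1: "heat_avg u y t \<theta> - heat_avg u ?y t \<theta> \<le> f y t + M * min 1 (pen_rate * \<theta>)"
          unfolding avg
        proof (rule heat_avg_le_of_penalised_max [OF yt(1,2) \<theta> less_imp_le [OF M_pos]])
          show "integrable heat_prob (\<lambda>z. f (y + sqrt \<theta> *\<^sub>R z) (t - \<theta>))"
            using integrable_u [of ?y "sqrt \<theta>" "t - \<theta>"] by (simp add: f_def add_ac)
          show "f (y + sqrt \<theta> *\<^sub>R z) (t - \<theta>) \<le> f y t + M * (penalty x0 t0 (y + sqrt \<theta> *\<^sub>R z) (t - \<theta>) - penalty x0 t0 y t)" for z
            using yt(1) \<theta> by (intro yt(4)) simp
        qed
        show "\<eta> / 2 * indicator {\<rho>..} \<theta> - M * min 1 (pen_rate * \<theta>)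
          \<le> (u y t - heat_avg u y t \<theta>) - (u ?y t - heat_avg u ?y t \<theta>)"
        proof (cases "\<rho> \<le> \<theta>")
          case True
          have "h / sqrt \<theta> \<le> h / sqrt \<rho>" using True \<rho> h by (intro divide_left_mono) auto
          also have "\<dots> \<le> r0" using h \<rho> by (simp add: pos_divide_le_eq)
          finally have "M * ((h / sqrt \<theta>) * pen_rate + (h / sqrt \<theta>)\<^sup>2) \<le> \<eta> / 2"
            using h \<theta> by (intro r0_small) auto
          then have "heat_avg u y t \<theta> - heat_avg u ?y t \<theta> \<le> \<eta> / 2"
            using heat_avg_shift_le [OF \<theta>, of h y t] h by linarith
          moreover have "0 \<le> M * min 1 (pen_rate * \<theta>)" using M_pos constants(2) \<theta> by simp
          moreover have "indicat_real {\<rho>..} \<theta> = 1" using True by simp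
          ultimately show ?thesis unfolding D using f0 yt(3) by simp
        next
          case False
          then have "indicat_real {\<rho>..} \<theta> = 0" by simp
          then show ?thesis unfolding D using 1 by simp
        qed
      qed
      also have "(y \<bullet> e) * u y t powr p - (?y \<bullet> e) * u ?y t powr p \<le> (2 * \<Lambda> + 1) * M powr p"
      proof -
        have ee: "e \<bullet> e = 1" using e by simp
        have fpos: "u ?y t \<le> u y t" using f0 yt(3) \<eta> by (simp add: f_def)
        have um: "u y t powr p \<le> M powr p" using pos [of y t] bounded [of y t] p by (intro powr_mono2) auto
        have "(norm (y - x0))\<^sup>2 \<le> 1" using yt(1,2) by linarith
        then have "norm (y - x0) \<le> 1" using power2_le_imp_le [of "norm (y - x0)" 1] by simp
        moreover have "\<bar>(y - x0) \<bullet> e\<bar> \<le> norm (y - x0)" using Basis_le_norm [OF e] .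
        ultimately have y1: "y \<bullet> e \<le> 2 * \<Lambda> + 1" using x0 by (simp add: inner_diff_left)
        show ?thesis
        proof (cases "0 \<le> y \<bullet> e")
          case True
          then have "0 \<le> (?y \<bullet> e) * u ?y t powr p" using h ee by (simp add: inner_add_left)
          moreover have "(y \<bullet> e) * u y t powr p \<le> (2 * \<Lambda> + 1) * M powr p"
            using True y1 um \<Lambda> by (intro mult_mono) auto
          ultimately show ?thesis by linarith
        next
          case False
          \<comment> \<open>Here the difference is (y . e) (u(y)^p - u(y + h e)^p) - h u(y + h e)^p,
            and both terms are non-positive.\<close>
          have "u ?y t powr p \<le> u y t powr p" using fpos pos [of ?y t] p by (intro powr_mono2) auto
          then have "(y \<bullet> e) * (u y t powr p - u ?y t powr p) \<le> 0"
            using False by (intro mult_nonpos_nonneg) auto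
          moreover have "0 \<le> h * u ?y t powr p" using h by simp
          moreover have "0 \<le> (2 * \<Lambda> + 1) * M powr p" using \<Lambda> by simp
          ultimately show ?thesis using ee by (simp add: inner_add_left algebra_simps)
        qed
      qed
      finally show False using big by linarith
    qed
  qed
qed

section \<open>The antisymmetric excess over the reflected solution\<close>

definition excess :: "real \<Rightarrow> real ^ 'n \<Rightarrow> real \<Rightarrow> real" where
  "excess l y t = u y t - u (reflect e l y) t"

lemma excess_reflect: "excess l (reflect e l y) t = - excess l y t"
  using e by (simp add: excess_def)

lemma abs_excess_le: "\<bar>excess l y t\<bar> \<le> M"
  using pos [of y t] bounded [of y t] pos [of "reflect e l y" t] bounded [of "reflect e l y" t]
  by (simp add: excess_def)

lemma continuous_reflect: "continuous_on S (reflect e l)"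
  unfolding reflect_def by (intro continuous_intros)

lemma continuous_excess: "continuous_on UNIV (\<lambda>(y, t). excess l y t)"
proof -
  have "continuous_on UNIV (\<lambda>q. (\<lambda>(x, t). u x t) (fst q, snd q) - (\<lambda>(x, t). u x t) (reflect e l (fst q), snd q))"
    by (intro continuous_on_diff continuous_on_compose2 [OF cont] continuous_intros
      continuous_on_compose2 [OF continuous_reflect [of UNIV]]) auto
  then show ?thesis by (simp add: excess_def case_prod_unfold)
qed

lemma excess_measurable [measurable]: "(\<lambda>y. excess l y t) \<in> borel_measurable borel"
  unfolding excess_def by measurable

text \<open>The Gaussian law is invariant under reflection through the origin's hyperplane, so
  averaging about the mirror image equals averaging the reflected function about the point.\<close>

lemma heat_avg_excess:
  "heat_avg u y t \<theta> - heat_avg u (reflect e l y) t \<theta> = heat_avg (excess l) y t \<theta>"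
proof -
  have r: "reflect e l y + sqrt \<theta> *\<^sub>R reflect e 0 z = reflect e l (y + sqrt \<theta> *\<^sub>R z)" for z
    using e by (simp add: reflect_def inner_add_left algebra_simps)
  have "heat_avg u (reflect e l y) t \<theta> = (\<integral>z. u (reflect e l y + sqrt \<theta> *\<^sub>R reflect e 0 z) (t - \<theta>) \<partial>heat_prob)"
    unfolding heat_avg_def
    by (rule integral_heat_prob_reflect_0 [OF e, symmetric]) measurable
  moreover have "integrable heat_prob (\<lambda>z. u (reflect e l (y + sqrt \<theta> *\<^sub>R z)) (t - \<theta>))"
    by (rule integrable_heat_prob_bounded [of _ M]) (auto simp: abs_le_M)
  ultimately show ?thesis by (simp add: heat_avg_def excess_def r)
qed

text \<open>The 4 collects two halves: the penalised value is at least m/2, and the barrier stays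
  above half of that value. The factor 1/s is from integrating \<theta>^(-1-s) over \<theta> \<ge>
  d^2. In \<open>loss\<close> the 2 is that of the penalty height 2 \<epsilon> m.\<close>

definition gain :: real where "gain = rate * tail / (4 * s)"
definition loss :: real where "loss = 2 * rate * pen_cost"

lemma gain_pos: "0 < gain" and loss_nonneg: "0 \<le> loss"
  using constants s by (simp_all add: gain_def loss_def)

text \<open>The penalised maximum provides a barrier \<open>q\<close> with q \<ge> excess on the
  near half-space and q \<ge> \<phi>/2 everywhere. In the sum over a mirror pair the excess cancels,
  so the pair sum of q - excess is at least \<phi>: this is the input of
  \<open>integral_reflection_lower\<close>.\<close>

lemma excess_estimate:
  assumes m: "0 < m" "\<And>y t. y \<bullet> e \<le> l \<Longrightarrow> excess l y t \<le> m"
    and \<epsilon>: "0 < \<epsilon>" "\<epsilon> \<le> 1/5"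
    and x0: "x0 \<bullet> e \<le> l" "(1 - \<epsilon>) * m \<le> excess l x0 t0"
  obtains y t where "y \<bullet> e < l" "m / 2 \<le> excess l y t"
    "m * (gain * (l - y \<bullet> e) powr (- 2 * s) - loss * \<epsilon>)
      \<le> (y \<bullet> e) * u y t powr p - (2 * l - y \<bullet> e) * u (reflect e l y) t powr p"
proof -
  let ?H = "{y :: real ^ 'n. y \<bullet> e \<le> l}" and ?A = "2 * \<epsilon> * m"
  have A: "0 \<le> ?A" using \<epsilon> m by simp
  \<comment> \<open>The bound 1/5 solves 2 \<epsilon> = (1 - \<epsilon>)/2: up to there the penalty
    height is at most half of the value at the maximum.\<close>
  have e5: "\<epsilon> * m \<le> m / 5" using mult_right_mono [OF \<epsilon>(2), of m] m by simp
  have "0 < \<epsilon> * m" using \<epsilon> m by simp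
  then have mA: "m - ?A \<le> excess l x0 t0"
    using x0(2) by (simp add: left_diff_distrib)
  have cl: "closed ?H" by (intro closed_Collect_le continuous_intros)
  obtain y t where yt: "y \<bullet> e \<le> l" "t \<le> t0" "(norm (y - x0))\<^sup>2 + (t0 - t) \<le> 1" "excess l x0 t0 \<le> excess l y t"
    "\<And>y' \<tau>. y' \<bullet> e \<le> l \<Longrightarrow> \<tau> \<le> t0 \<Longrightarrow> excess l y' \<tau> \<le> excess l y t + ?A * (penalty x0 t0 y' \<tau> - penalty x0 t0 y t)"
    by (rule penalised_max [OF cl _ continuous_excess, where ?x0.0 = x0 and m = m and A = ?A and ?t0.0 = t0 and l1 = l])
      (use m mA A x0(1) in auto)
  define \<phi> where "\<phi> = excess l y t"
  have \<phi>: "(1 - \<epsilon>) * m \<le> \<phi>" using x0(2) yt(4) by (simp add: \<phi>_def)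
  have half: "m / 2 \<le> \<phi>" and A\<phi>: "?A \<le> \<phi> / 2"
  proof -
    have "m - \<epsilon> * m \<le> \<phi>" using \<phi> by (simp only: left_diff_distrib mult_1)
    then show "m / 2 \<le> \<phi>" "?A \<le> \<phi> / 2" using e5 m(1) unfolding mult.assoc by linarith+
  qed
  have \<phi>0: "0 < \<phi>" using half m by linarith
  have "y \<bullet> e \<noteq> l"
  proof
    assume "y \<bullet> e = l"
    then have "\<phi> = 0" by (simp add: \<phi>_def excess_def reflect_def)
    then show False using \<phi>0 by simp
  qed
  then have ye: "y \<bullet> e < l" using yt(1) by simp
  define d where "d = l - y \<bullet> e"
  have d: "0 < d" using ye by (simp add: d_def)
  let ?y = "reflect e l y"
  have "rate * (\<phi> / 2 * tail * ((d\<^sup>2) powr (- s) / s) - ?A * pen_cost)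
    \<le> (y \<bullet> e) * u y t powr p - (?y \<bullet> e) * u ?y t powr p"
  proof (rule difference_lower)
    show "0 < d\<^sup>2" using d by simp
    fix \<theta> :: real assume \<theta>: "0 < \<theta>"
    let ?r = "sqrt \<theta>" and ?pen = "\<lambda>z. penalty x0 t0 (y + sqrt \<theta> *\<^sub>R z) (t - \<theta>)"
    define q where "q z = \<phi> + ?A * (?pen z - penalty x0 t0 y t)" for z
    define \<Phi> where "\<Phi> z = excess l (y + ?r *\<^sub>R z) (t - \<theta>)" for z
    \<comment> \<open>Distance to the plane in Gaussian units; it is at most 1 exactly when \<theta>
      \<ge> d^2, which is why d^2 is the cutoff.\<close>
    define k where "k = d / ?r"
    have k: "0 < k" using d \<theta> by (simp add: k_def)
    have tt: "t - \<theta> \<le> t0" using yt(2) \<theta> by simp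
    have pen01: "0 \<le> ?pen z" "?pen z \<le> 1" for z
      using tt by (auto intro: penalty_nonneg penalty_le_1)
    have [measurable]: "q \<in> borel_measurable borel" "\<Phi> \<in> borel_measurable borel"
      unfolding q_def \<Phi>_def by measurable
    have q_ge: "\<phi> / 2 \<le> q z" for z
    proof -
      have "?A * (- 1) \<le> ?A * (?pen z - penalty x0 t0 y t)"
        using A pen01 [of z] penalty_le_1 [of x0 t0 y t] by (intro mult_left_mono) auto
      then show ?thesis using A\<phi> by (simp add: q_def)
    qed
    have q_le: "q z \<le> \<phi> + ?A" for z
    proof -
      have "?A * (?pen z - penalty x0 t0 y t) \<le> ?A * 1"
        using A pen01 [of z] penalty_nonneg [OF yt(2), of x0 y] by (intro mult_left_mono) auto
      then show ?thesis by (simp add: q_def)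
    qed
    have \<Phi>_le: "\<bar>\<Phi> z\<bar> \<le> M" for z unfolding \<Phi>_def by (rule abs_excess_le)
    have int\<Phi>: "integrable heat_prob \<Phi>" by (rule integrable_heat_prob_bounded [OF _ \<Phi>_le]) measurable
    have q_abs: "\<bar>q z\<bar> \<le> \<phi> + ?A" for z using q_ge [of z] q_le [of z] \<phi>0 by linarith
    have intq: "integrable heat_prob q" by (rule integrable_heat_prob_bounded [OF _ q_abs]) measurable
    have rfl: "y + ?r *\<^sub>R reflect e k z = reflect e l (y + ?r *\<^sub>R z)" for z
    proof -
      have "?r * k = d" using \<theta> by (simp add: k_def)
      then have "?r *\<^sub>R ((2 * (k - z \<bullet> e)) *\<^sub>R e) = (2 * (d - ?r * (z \<bullet> e))) *\<^sub>R e"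
        by (simp add: right_diff_distrib algebra_simps)
      then show ?thesis
        by (simp add: reflect_def scaleR_add_right inner_add_left d_def diff_diff_eq add.assoc)
    qed
    have "\<phi> / 2 * measure heat_prob {z. z \<bullet> e > k} \<le> (\<integral>z. q z - \<Phi> z \<partial>heat_prob)"
    proof (rule integral_reflection_lower [OF e _ _ k])
      show "(\<lambda>z. q z - \<Phi> z) \<in> borel_measurable borel" by measurable
      show "\<bar>q z - \<Phi> z\<bar> \<le> \<phi> + ?A + M" for z
        using q_ge [of z] q_le [of z] \<Phi>_le [of z] \<phi>0 by linarith
      show "0 \<le> \<phi> / 2" using \<phi>0 by simp
      show "0 \<le> q z - \<Phi> z" if "z \<bullet> e \<le> k" for z
      proof -
        have "?r * (z \<bullet> e) \<le> d" using that \<theta> by (simp add: k_def pos_le_divide_eq mult.commute)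
        then have "(y + ?r *\<^sub>R z) \<bullet> e \<le> l" by (simp add: inner_add_left d_def)
        then show ?thesis using yt(5) [OF _ tt] by (simp add: q_def \<Phi>_def \<phi>_def)
      qed
      show "2 * (\<phi> / 2) \<le> q z - \<Phi> z + (q (reflect e k z) - \<Phi> (reflect e k z))" for z
      proof -
        have "\<Phi> (reflect e k z) = - \<Phi> z" by (simp add: \<Phi>_def rfl excess_reflect)
        then show ?thesis using q_ge [of z] q_ge [of "reflect e k z"] by linarith
      qed
    qed
    also have "\<dots> = (\<integral>z. q z \<partial>heat_prob) - heat_avg (excess l) y t \<theta>"
      using intq int\<Phi> unfolding heat_avg_def \<Phi>_def [symmetric] by simp
    also have "(\<integral>z. q z \<partial>heat_prob) \<le> \<phi> + ?A * min 1 (pen_rate * \<theta>)"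
      by (rule heat_avg_le_of_penalised_max [OF yt(2,3) \<theta> A intq]) (simp add: q_def)
    finally have 1: "\<phi> / 2 * measure heat_prob {z. z \<bullet> e > k} - ?A * min 1 (pen_rate * \<theta>)
      \<le> \<phi> - heat_avg (excess l) y t \<theta>" by simp
    have D: "(u y t - heat_avg u y t \<theta>) - (u ?y t - heat_avg u ?y t \<theta>) = \<phi> - heat_avg (excess l) y t \<theta>"
      using heat_avg_excess [of y t \<theta> l] by (simp add: \<phi>_def excess_def)
    have 2: "\<phi> / 2 * tail * indicator {d\<^sup>2..} \<theta> \<le> \<phi> / 2 * measure heat_prob {z. z \<bullet> e > k}"
    proof (cases "d\<^sup>2 \<le> \<theta>")
      case True
      then have "d \<le> ?r" using d by (simp add: real_le_rsqrt)
      then have "k \<le> 1" using \<theta> by (simp add: k_def)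
      then have "tail \<le> measure heat_prob {z. z \<bullet> e > k}" unfolding tail_def by (rule heat_tail_antimono)
      then show ?thesis using True \<phi>0 by (simp add: mult_left_mono)
    next
      case False
      then have "indicat_real {d\<^sup>2..} \<theta> = 0" by simp
      then show ?thesis using \<phi>0 by simp
    qed
    show "\<phi> / 2 * tail * indicator {d\<^sup>2..} \<theta> - ?A * min 1 (pen_rate * \<theta>)
      \<le> (u y t - heat_avg u y t \<theta>) - (u ?y t - heat_avg u ?y t \<theta>)"
      unfolding D using 1 2 by linarith
  qed
  moreover have "m * (gain * d powr (- 2 * s) - loss * \<epsilon>)
    \<le> rate * (\<phi> / 2 * tail * ((d\<^sup>2) powr (- s) / s) - ?A * pen_cost)"
  proof -
    have dd: "(d\<^sup>2) powr (- s) = d powr (- 2 * s)"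
      using d by (simp add: powr_powr flip: powr_numeral)
    have "rate * (m / 2 / 2 * tail * (d powr (- 2 * s) / s)) \<le> rate * (\<phi> / 2 * tail * (d powr (- 2 * s) / s))"
      using half constants s by (intro mult_left_mono mult_right_mono) auto
    moreover have "m * (gain * d powr (- 2 * s)) = rate * (m / 2 / 2 * tail * (d powr (- 2 * s) / s))"
      by (simp add: gain_def)
    moreover have "m * (loss * \<epsilon>) = rate * (?A * pen_cost)" by (simp add: loss_def)
    ultimately show ?thesis by (simp only: dd right_diff_distrib)
  qed
  ultimately show thesis
    using that [of y t] ye half e by (simp add: d_def \<phi>_def)
qed

text \<open>The constants are fixed in the order d0, \<delta>, \<eta>, before the plane and the
  supremum m are known. Only \<epsilon> depends on m; it serves to make the penalty negligible
  within the contradiction.\<close>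

lemma excess_gap:
  assumes \<Lambda>: "0 < \<Lambda>"
  obtains \<eta> where "0 < \<eta>"
    "\<And>l x0 t0. l \<le> \<Lambda> \<Longrightarrow> x0 \<bullet> e \<le> l \<Longrightarrow> 0 < excess l x0 t0 \<Longrightarrow>
      \<exists>y t. 0 < y \<bullet> e \<and> y \<bullet> e < l \<and> \<eta> < excess l y t"
proof -
  \<comment> \<open>Lipschitz constant of the map a to x_1 a^p for 0 < x_1 \<le> \<Lambda> and 0 < a
    \<le> M.\<close>
  let ?B = "\<Lambda> * p * M powr (p - 1)"
  have B: "0 < ?B" using \<Lambda> p M_pos by simp
  \<comment> \<open>Within distance d0 of the plane half of the gain beats this Lipschitz
    constant.\<close>
  obtain d0 where d0: "0 < d0" "2 * ?B / gain < d0 powr (- (2 * s))"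
    using ex_powr_neg_large [of "2 * s"] s by auto
  have d0': "?B < gain * d0 powr (- (2 * s)) / 2"
    using d0(2) gain_pos by (simp add: pos_divide_less_eq mult.commute)
  define g where "g = gain * \<Lambda> powr (- (2 * s)) / 2"
  have g: "0 < g" using gain_pos \<Lambda> by (simp add: g_def)
  define w where "w = g / (2 * (\<Lambda> * p))"
  have w: "0 < w" "\<Lambda> * p * w < g" using g \<Lambda> p by (simp_all add: w_def)
  \<comment> \<open>If the solution is at most 2 \<delta>, its own Lipschitz factor \<Lambda> p
    a^(p-1) is below half of the gain, even at the largest distance \<Lambda>.\<close>
  define \<delta> where "\<delta> = w powr (1 / (p - 1)) / 2"
  have \<delta>: "0 < \<delta>" "\<Lambda> * p * (2 * \<delta>) powr (p - 1) < g"
    using w p by (simp_all add: \<delta>_def powr_powr)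
  \<comment> \<open>\<eta> \<le> \<delta> gives a \<le> 2 \<delta> once b \<le> \<delta>; the other
    bound keeps B \<eta> below the last term 2 d b^p when d > d0 and b > \<delta>.\<close>
  define \<eta> where "\<eta> = min \<delta> (d0 * \<delta> powr p / ?B)"
  have \<eta>: "0 < \<eta>" "\<eta> \<le> \<delta>" using \<delta> d0 B by (simp_all add: \<eta>_def)
  have \<eta>2: "?B * \<eta> < 2 * (d0 * \<delta> powr p)"
  proof -
    have "\<eta> \<le> d0 * \<delta> powr p / ?B" by (simp add: \<eta>_def)
    then have "?B * \<eta> \<le> d0 * \<delta> powr p" using B by (simp add: pos_le_divide_eq mult.commute)
    also have "\<dots> < 2 * (d0 * \<delta> powr p)" using d0 \<delta> by simp
    finally show ?thesis .
  qed
  show thesis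
  proof
    show "0 < \<eta>" by (fact \<eta>(1))
    fix l x0 t0 assume l: "l \<le> \<Lambda>" and x0: "x0 \<bullet> e \<le> l" "0 < excess l x0 t0"
    show "\<exists>y t. 0 < y \<bullet> e \<and> y \<bullet> e < l \<and> \<eta> < excess l y t"
    proof (rule ccontr)
      assume "\<not> ?thesis"
      then have small: "excess l y t \<le> \<eta>" if "0 < y \<bullet> e" "y \<bullet> e < l" for y t
        using that by (meson not_less)
      define V where "V = {excess l y t | y t. y \<bullet> e \<le> l}"
      have V: "bdd_above V" "excess l x0 t0 \<in> V"
        using abs_excess_le x0 by (auto simp: V_def bdd_above_def abs_le_iff)
      define m where "m = Sup V"
      have m_ge: "excess l y t \<le> m" if "y \<bullet> e \<le> l" for y t
        unfolding m_def by (rule cSup_upper [OF _ V(1)]) (use that in \<open>auto simp: V_def\<close>)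
      have m: "0 < m" using m_ge [OF x0(1)] x0(2) by (rule less_le_trans [rotated])
      \<comment> \<open>Half of the gain at distance \<Lambda> + 1, the largest that occurs when y .
        e > -1.\<close>
      define g1 where "g1 = gain * (\<Lambda> + 1) powr (- (2 * s)) / 2"
      have g1: "0 < g1" using gain_pos \<Lambda> by (simp add: g1_def)
      \<comment> \<open>The second entry keeps the loss below half of the gain for y . e > -1. The
        third keeps m times the loss below (m/2)^p, for use further left.\<close>
      define \<epsilon> where "\<epsilon> = min (1/5) (min (g1 / (loss + 1)) ((m / 2) powr p / (2 * m * (loss + 1))))"
      have "0 < \<epsilon>" using g1 m loss_nonneg by (simp add: \<epsilon>_def)
      moreover have "\<epsilon> \<le> 1/5" unfolding \<epsilon>_def by (rule min.cobounded1)
      ultimately have \<epsilon>: "0 < \<epsilon>" "\<epsilon> \<le> 1/5" .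
      have \<epsilon>1: "loss * \<epsilon> \<le> g1"
      proof -
        have "\<epsilon> \<le> g1 / (loss + 1)" by (simp add: \<epsilon>_def)
        then have "\<epsilon> * (loss + 1) \<le> g1" using loss_nonneg by (simp add: pos_le_divide_eq)
        then show ?thesis using \<epsilon> by (simp add: algebra_simps)
      qed
      have \<epsilon>2: "m * (loss * \<epsilon>) < (m / 2) powr p"
      proof -
        have "\<epsilon> \<le> (m / 2) powr p / (2 * m * (loss + 1))" by (simp add: \<epsilon>_def)
        then have "\<epsilon> * (2 * m * (loss + 1)) \<le> (m / 2) powr p"
          using loss_nonneg m by (simp add: pos_le_divide_eq)
        moreover have "m * (loss * \<epsilon>) < \<epsilon> * (2 * m * (loss + 1))"
        proof -
          have "0 \<le> m * (loss * \<epsilon>)" "0 < m * \<epsilon>" using m loss_nonneg \<epsilon> by simp_all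
          moreover have "\<epsilon> * (2 * m * (loss + 1)) = 2 * (m * (loss * \<epsilon>)) + 2 * (m * \<epsilon>)"
            by (simp add: algebra_simps)
          ultimately show ?thesis by linarith
        qed
        ultimately show ?thesis by linarith
      qed
      have "(1 - \<epsilon>) * m < m" using \<epsilon> m by simp
      then obtain x1 t1 where x1: "x1 \<bullet> e \<le> l" "(1 - \<epsilon>) * m < excess l x1 t1"
        using less_cSupD [of V "(1 - \<epsilon>) * m"] V(2) by (auto simp: m_def V_def)
      obtain y t where yt: "y \<bullet> e < l" "m / 2 \<le> excess l y t"
        "m * (gain * (l - y \<bullet> e) powr (- 2 * s) - loss * \<epsilon>)
          \<le> (y \<bullet> e) * u y t powr p - (2 * l - y \<bullet> e) * u (reflect e l y) t powr p"
        by (rule excess_estimate [OF m m_ge \<epsilon> x1(1) less_imp_le [OF x1(2)]])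
      define d a b where "d = l - y \<bullet> e" and "a = u y t" and "b = u (reflect e l y) t"
      have d: "0 < d" using yt(1) by (simp add: d_def)
      have ab: "0 < b" "a - b \<le> m" "m / 2 \<le> a - b" "b \<le> a" "a \<le> M"
        using pos bounded m m_ge [of y t] yt by (simp_all add: a_def b_def excess_def)
      \<comment> \<open>As 2 l - y . e = y . e + 2 d, the right-hand side splits into a difference
        of powers and the negative term - 2 d b^p.\<close>
      have est: "m * (gain * d powr (- (2 * s)) - loss * \<epsilon>) \<le> (y \<bullet> e) * (a powr p - b powr p) - 2 * d * b powr p"
        using yt(3) by (simp add: d_def a_def b_def algebra_simps)
      have bp: "0 \<le> 2 * d * b powr p" using d by simp
      have mono: "b powr p \<le> a powr p" using ab p by (intro powr_mono2) auto
      have d_far: "2 * g1 \<le> gain * d powr (- (2 * s))" if "d \<le> \<Lambda> + 1"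
        using that d s gain_pos unfolding g1_def by (simp add: mult_left_mono powr_mono2')
      \<comment> \<open>Far to the left the gain d^(-2s) may be arbitrarily small, so there the
        coefficient, at most -1, must absorb the loss. Between -1 and 0 its sign suffices, since d
        is bounded and the gain absorbs the loss.\<close>
      consider "y \<bullet> e \<le> -1" | "-1 < y \<bullet> e" "y \<bullet> e \<le> 0" | "0 < y \<bullet> e" by linarith
      then show False
      proof cases
        case 1
        have "(m / 2) powr p \<le> (a - b) powr p" using ab m p by (intro powr_mono2) auto
        also have "\<dots> \<le> a powr p - b powr p" using ab p by (intro powr_diff_ge) auto
        finally have ge: "(m / 2) powr p \<le> a powr p - b powr p" .
        have "(y \<bullet> e) * (a powr p - b powr p) \<le> (-1) * (a powr p - b powr p)"
          using 1 mono by (intro mult_right_mono) auto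
        then have "m * (gain * d powr (- (2 * s))) - m * (loss * \<epsilon>) \<le> - ((m / 2) powr p)"
          using est bp ge by (simp add: right_diff_distrib)
        moreover have "0 \<le> m * (gain * d powr (- (2 * s)))" using m gain_pos by simp
        ultimately show False using \<epsilon>2 by linarith
      next
        case 2
        have "(y \<bullet> e) * (a powr p - b powr p) \<le> 0" using 2 mono by (intro mult_nonpos_nonneg) auto
        then have "m * (gain * d powr (- (2 * s)) - loss * \<epsilon>) \<le> 0" using est bp by linarith
        moreover have "0 < gain * d powr (- (2 * s)) - loss * \<epsilon>"
          using d_far \<epsilon>1 g1 2 l by (simp add: d_def)
        ultimately show False using m by (simp add: mult_le_0_iff)
      next
        case 3
        have d\<Lambda>: "d \<le> \<Lambda>" using 3 l by (simp add: d_def)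
        have "gain * d powr (- (2 * s)) / 2 \<le> gain * d powr (- (2 * s)) - loss * \<epsilon>"
          using d_far d\<Lambda> \<epsilon>1 by simp
        then have "m * (gain * d powr (- (2 * s)) / 2) \<le> m * (gain * d powr (- (2 * s)) - loss * \<epsilon>)"
          using m by (intro mult_left_mono) auto
        then have L: "m * (gain * d powr (- (2 * s)) / 2) \<le> (y \<bullet> e) * (a powr p - b powr p) - 2 * d * b powr p"
          using est by linarith
        have R: "(y \<bullet> e) * (a powr p - b powr p) \<le> \<Lambda> * (p * a powr (p - 1) * (a - b))"
          using 3 yt(1) l mono powr_diff_le [OF ab(1,4) p] by (intro mult_mono) auto
        have aM: "a powr (p - 1) \<le> M powr (p - 1)" using ab p by (intro powr_mono2) auto
        \<comment> \<open>The linearised right-hand side is at most \<Lambda> p a^(p-1) m, as a - b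
          \<le> m; the common factor m cancels.\<close>
        have below: False if "\<Lambda> * p * a powr (p - 1) < gain * d powr (- (2 * s)) / 2"
        proof -
          have "\<Lambda> * (p * a powr (p - 1) * (a - b)) \<le> \<Lambda> * (p * a powr (p - 1) * m)"
            using \<Lambda> p ab by (intro mult_left_mono) auto
          also have "\<dots> = (\<Lambda> * p * a powr (p - 1)) * m" by simp
          also have "\<dots> < (gain * d powr (- (2 * s)) / 2) * m"
            using that m by (intro mult_strict_right_mono)
          also have "\<dots> = m * (gain * d powr (- (2 * s)) / 2)" by simp
          finally show False using L R bp by linarith
        qed
        have aB: "\<Lambda> * p * a powr (p - 1) \<le> ?B" using aM \<Lambda> p by (intro mult_left_mono) auto
        consider "d \<le> d0" | "d0 < d" "b \<le> \<delta>" | "d0 < d" "\<delta> < b" by linarith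
        then show False
        proof cases
          case 1
          then have "d0 powr (- (2 * s)) \<le> d powr (- (2 * s))" using d s by (intro powr_mono2') auto
          then have "gain * d0 powr (- (2 * s)) \<le> gain * d powr (- (2 * s))"
            using gain_pos by (intro mult_left_mono) auto
          then show False using d0' aB by (intro below) linarith
        next
          case 2
          have "a - b \<le> \<eta>" using small [of y t] 3 yt(1) by (simp add: a_def b_def excess_def)
          then have "a \<le> 2 * \<delta>" using 2 \<eta> by linarith
          then have "a powr (p - 1) \<le> (2 * \<delta>) powr (p - 1)" using ab p by (intro powr_mono2) auto
          then have "\<Lambda> * p * a powr (p - 1) \<le> \<Lambda> * p * (2 * \<delta>) powr (p - 1)"
            using \<Lambda> p by (intro mult_left_mono) auto
          moreover have "\<Lambda> powr (- (2 * s)) \<le> d powr (- (2 * s))" using d d\<Lambda> s by (intro powr_mono2') auto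
          then have "g \<le> gain * d powr (- (2 * s)) / 2"
            using gain_pos unfolding g_def by (simp add: mult_left_mono)
          ultimately show False using \<delta>(2) by (intro below) linarith
        next
          case 3
          have "a - b \<le> \<eta>" using small [of y t] \<open>0 < y \<bullet> e\<close> yt(1) by (simp add: a_def b_def excess_def)
          then have "(\<Lambda> * p * a powr (p - 1)) * (a - b) \<le> ?B * \<eta>"
            using ab B m by (intro mult_mono [OF aB]) auto
          moreover have "d0 * \<delta> powr p \<le> d * b powr p"
            using 3 d0 \<delta> p by (intro mult_mono powr_mono2) auto
          moreover have "0 \<le> m * (gain * d powr (- (2 * s)) / 2)" using m gain_pos by simp
          ultimately show False using L R \<eta>2 by (simp add: mult.assoc)
        qed
      qed
    qed
  qed
qed

section \<open>Advancing the plane, and monotonicity\<close>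

text \<open>A single \<eta> serves all planes up to \<Lambda>, and the modulus for that \<eta> fixes
  h0. Advancing the plane by h0/2 moves every mirror image by h0, which cannot create an excess
  above \<eta>; by the gap it then creates no positive excess at all.\<close>

lemma excess_nonpos:
  assumes "y \<bullet> e \<le> l"
  shows "excess l y t \<le> 0"
proof -
  define \<Lambda> where "\<Lambda> = max 1 l"
  have \<Lambda>: "0 < \<Lambda>" "l \<le> \<Lambda>" by (simp_all add: \<Lambda>_def)
  obtain \<eta> where \<eta>: "0 < \<eta>" "\<And>l x0 t0. l \<le> \<Lambda> \<Longrightarrow> x0 \<bullet> e \<le> l \<Longrightarrow> 0 < excess l x0 t0 \<Longrightarrow>
      \<exists>y t. 0 < y \<bullet> e \<and> y \<bullet> e < l \<and> \<eta> < excess l y t"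
    using excess_gap [OF \<Lambda>(1)] by blast
  obtain h0 where h0: "0 < h0" "\<And>h y t. 0 < h \<Longrightarrow> h \<le> h0 \<Longrightarrow> 0 \<le> y \<bullet> e \<Longrightarrow> y \<bullet> e \<le> 2 * \<Lambda> \<Longrightarrow>
      u y t - u (y + h *\<^sub>R e) t \<le> \<eta>"
    using uniform_modulus [OF less_imp_le [OF \<Lambda>(1)] \<eta>(1)] by blast
  have ee: "e \<bullet> e = 1" using e by simp
  have all: "\<forall>y t. y \<bullet> e \<le> l \<longrightarrow> excess l y t \<le> 0" if "l \<le> real k * (h0 / 2)" "l \<le> \<Lambda>" for k l
    using that
  proof (induction k arbitrary: l)
    \<comment> \<open>For l \<le> 0 the strip in which the gap places its witness is empty.\<close>
    case 0
    show ?case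
    proof (intro allI impI, rule ccontr)
      fix y t assume "y \<bullet> e \<le> l" "\<not> excess l y t \<le> 0"
      then obtain y' where "0 < y' \<bullet> e" "y' \<bullet> e < l" using \<eta>(2) [OF 0(2)] by (meson not_le)
      then show False using 0(1) by simp
    qed
  next
    case (Suc k)
    define l' where "l' = l - h0 / 2"
    have l': "l' \<le> real k * (h0 / 2)" "l' \<le> \<Lambda>" using Suc.prems h0(1) by (simp_all add: l'_def algebra_simps)
    show ?case
    proof (intro allI impI, rule ccontr)
      fix y t assume "y \<bullet> e \<le> l" "\<not> excess l y t \<le> 0"
      then obtain y t where y: "0 < y \<bullet> e" "y \<bullet> e < l" "\<eta> < excess l y t"
        using \<eta>(2) [OF Suc.prems(2)] by (meson not_le)
      show False
      proof (cases "y \<bullet> e \<le> l'")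
        case True
        let ?z = "reflect e l' y"
        have "u y t \<le> u ?z t" using Suc.IH [OF l'] True by (auto simp: excess_def)
        \<comment> \<open>The old mirror image has first coordinate 2 l' - y . e, between 0 and 2
          \<Lambda> since y . e > 0 and l' \<le> \<Lambda>.\<close>
        moreover have "u ?z t - u (?z + h0 *\<^sub>R e) t \<le> \<eta>"
          using h0(1) True y(1) l'(2) e by (intro h0(2)) auto
        moreover have "?z + h0 *\<^sub>R e = reflect e l y"
        proof -
          have "2 * (l' - y \<bullet> e) + h0 = 2 * (l - y \<bullet> e)" by (simp add: l'_def)
          then show ?thesis unfolding reflect_def add.assoc scaleR_add_left [symmetric] by simp
        qed
        ultimately show False using y(3) by (simp add: excess_def)
      next
        case False
        \<comment> \<open>A point between the two planes is less than h0/2 from the new one, hence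
          less than h0 from its mirror image.\<close>
        have "u y t - u (y + (2 * (l - y \<bullet> e)) *\<^sub>R e) t \<le> \<eta>"
          using False y Suc.prems(2) by (intro h0(2)) (auto simp: l'_def)
        then show False using y(3) by (simp add: excess_def reflect_def)
      qed
    qed
  qed
  obtain k :: nat where "l / (h0 / 2) \<le> real k" using real_arch_simple by blast
  then have "l \<le> real k * (h0 / 2)" using h0(1) by (simp add: pos_divide_le_eq)
  then show ?thesis using all \<Lambda>(2) assms by blast
qed

text \<open>Reflection in the plane halfway between the two points exchanges them.\<close>

lemma increasing:
  assumes "0 \<le> h"
  shows "u y t \<le> u (y + h *\<^sub>R e) t"
  using excess_nonpos [of y "y \<bullet> e + h / 2" t] assms by (simp add: excess_def reflect_def)

section \<open>Growth of the coefficient against a fixed penalty cost\<close>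

text \<open>The penalised minimum near R e has cost independent of R. Translation back by R e lands
  in a fixed compact set, where \<open>u\<close> is at least c > 0, and monotonicity carries this
  bound to the minimum point.\<close>

lemma contradiction: False
proof -
  have "compact (cball (0 :: real ^ 'n) 1 \<times> {-1..0 :: real})" by (intro compact_Times) auto
  moreover have "cball (0 :: real ^ 'n) 1 \<times> {-1..0 :: real} \<noteq> {}" by auto
  ultimately obtain q where q: "\<And>x t. x \<in> cball 0 1 \<Longrightarrow> t \<in> {-1..0} \<Longrightarrow> u (fst q) (snd q) \<le> u x t"
    using continuous_attains_inf [of "cball (0 :: real ^ 'n) 1 \<times> {-1..0 :: real}" "\<lambda>(x, t). u x t"]
      continuous_on_subset [OF cont subset_UNIV] by (fastforce simp: case_prod_unfold)
  define c where "c = u (fst q) (snd q)"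
  have c: "0 < c" using pos by (simp add: c_def)
  have cp: "0 < c powr p" using c by simp
  \<comment> \<open>Makes (R - 1) c^p exceed the cost by exactly c^p; R - 1 bounds the first
    coordinate within distance 1 of R e from below.\<close>
  define R where "R = rate * (M * pen_cost) / c powr p + 2"
  have R: "2 \<le> R" using constants M_pos by (simp add: R_def)
  have fcont: "continuous_on UNIV (\<lambda>(x, t). - u x t)"
    using continuous_on_minus [OF cont] by (simp add: case_prod_unfold)
  let ?x0 = "R *\<^sub>R e"
  \<comment> \<open>A minimum of \<open>u\<close> is a maximum of \<open>- u\<close>, bounded above
    by 0 and below by -M, so height M is admissible at every centre.\<close>
  obtain y t where yt: "t \<le> 0" "(norm (y - ?x0))\<^sup>2 + (0 - t) \<le> 1"
    "\<And>y' \<tau>. \<tau> \<le> 0 \<Longrightarrow> - u y' \<tau> \<le> - u y t + M * (penalty ?x0 0 y' \<tau> - penalty ?x0 0 y t)"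
    by (rule penalised_max [OF closed_UNIV UNIV_I fcont, where m = 0 and A = M and ?x0.0 = "?x0" and ?t0.0 = 0])
      (use M_pos bounded less_imp_le [OF pos] in auto)
  have "(y \<bullet> e) * u y t powr p \<le> rate * (M * pen_cost)"
  proof (rule value_upper)
    fix \<theta> :: real assume \<theta>: "0 < \<theta>"
    have "(\<integral>z. - u (y + sqrt \<theta> *\<^sub>R z) (t - \<theta>) \<partial>heat_prob) \<le> - u y t + M * min 1 (pen_rate * \<theta>)"
      by (rule heat_avg_le_of_penalised_max [OF yt(1,2) \<theta> less_imp_le [OF M_pos]])
        (use yt \<theta> in auto)
    then show "u y t - heat_avg u y t \<theta> \<le> M * min 1 (pen_rate * \<theta>)"
      by (simp add: heat_avg_def)
  qed
  moreover have "(R - 1) * c powr p \<le> (y \<bullet> e) * u y t powr p"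
  proof (intro mult_mono)
    have "(norm (y - ?x0))\<^sup>2 \<le> 1" using yt(1,2) by linarith
    then have n: "norm (y - ?x0) \<le> 1" using power2_le_imp_le [of "norm (y - ?x0)" 1] by simp
    moreover have "\<bar>(y - ?x0) \<bullet> e\<bar> \<le> norm (y - ?x0)" using Basis_le_norm [OF e] .
    ultimately show ye: "R - 1 \<le> y \<bullet> e" using e by (simp add: inner_diff_left)
    have "-1 \<le> t" using yt(2) zero_le_power2 [of "norm (y - ?x0)"] by linarith
    then have "c \<le> u (y - ?x0) t" unfolding c_def using n yt(1) by (intro q) auto
    also have "\<dots> \<le> u (y - ?x0 + R *\<^sub>R e) t" using R by (intro increasing) simp
    finally show "c powr p \<le> u y t powr p" using c p by (intro powr_mono2) auto
    show "0 \<le> y \<bullet> e" using ye R by linarith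
  qed simp
  moreover have "(R - 1) * c powr p = rate * (M * pen_cost) + c powr p"
    using cp by (simp add: R_def algebra_simps)
  ultimately show False using cp by linarith
qed

end

theorem theorem1p2:
  fixes s p :: real and k :: "'n::finite"
  assumes "0 < s" and "s < 1" and "1 < p"
  shows "\<not> (\<exists>u :: real ^ 'n \<Rightarrow> real \<Rightarrow> real.
            (\<forall>x t. 0 < u x t) \<and>
            bdd_above (range (\<lambda>(x, t). u x t)) \<and>
            classical_solution s (\<lambda>x t. x $ k * u x t powr p) u)"
proof
  assume "\<exists>u :: real ^ 'n \<Rightarrow> real \<Rightarrow> real. (\<forall>x t. 0 < u x t) \<and>
    bdd_above (range (\<lambda>(x, t). u x t)) \<and>
    classical_solution s (\<lambda>x t. x $ k * u x t powr p) u"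
  then obtain u :: "real ^ 'n \<Rightarrow> real \<Rightarrow> real"
    where pos: "\<And>x t. 0 < u x t" and bdd: "bdd_above (range (\<lambda>(x, t). u x t))"
      and sol: "classical_solution s (\<lambda>x t. x $ k * u x t powr p) u"
    by blast
  obtain M where M: "\<And>q. q \<in> range (\<lambda>(x, t). u x t) \<Longrightarrow> q \<le> M"
    using bdd unfolding bdd_above_def by blast
  obtain \<alpha> where "parabolic_holder_loc \<alpha> u"
    using sol unfolding classical_solution_def by blast
  then have cont: "continuous_on UNIV (\<lambda>(x, t). u x t)"
    by (rule parabolic_holder_loc_continuous)
  interpret positive_master_solution s p M "axis k 1" u
  proof
    show "axis k (1::real) \<in> Basis" by (simp add: axis_in_Basis_iff)
    show "u x t \<le> M" for x t by (rule M) auto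
    show "has_master_value s u x t ((x \<bullet> axis k 1) * u x t powr p)" for x t
      using sol by (simp add: classical_solution_def inner_axis)
  qed (use assms pos cont in auto)
  show False by (rule contradiction)
qed

end
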